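(* Let $\langle k_n,l_n:n\in\mathbb N\rangle$ be positive integers with $k_n\ge2$ for all $n$ and $\sum_n 1/l_n<\infty$. Then $\alpha_n=p_n/q_n$ converges to an irrational number $\alpha$, and, letting $\nu$ be the unique non-atomic shift-invariant Borel probability measure on the circle factor $\mathcal K$, the system $(\mathcal K,\nu,sh)$ is measure-theoretically isomorphic to $(S^1,\lambda,\mathcal R_\alpha)$, where $\lambda$ is Lebesgue measure and $\mathcal R_\alpha$ is rotation by $\alpha$ (identifying $S^1$ with $[0,1)$ and $\mathcal R_\alpha x=x+\alpha\bmod1$).
   Context: Circular operator: let $k,l,p,q$ be positive integers with $p,q$ coprime. For $0\le i<q$ let $j_i\in\{0,\dots,q-1\}$ be the unique integer with $j_i\equiv p^{-1}i\pmod q$. For words $w_0,\dots,w_{k-1}$ over an alphabet $\Sigma\cup\{b,e\}$ (where $b,e\notin\Sigma$) define $\mathcal C(w_0,\dots,w_{k-1})=\prod_{i=0}^{q-1}\prod_{j=0}^{k-1} b^{q-j_i}w_j^{\,l-1}e^{j_i}$ (concatenation in increasing order of indices). Coefficients: $p_0=0$, $q_0=1$, $p_{n+1}=p_nq_nk_nl_n+1$, $q_{n+1}=k_nl_nq_n^2$, $\alpha_n=p_n/q_n$; $\mathcal C_n$ is $\mathcal C$ with $k=k_n,l=l_n,p=p_n,q=q_n$. Circle factor: with alphabet $\{*\}$, let $w_0=*$ and $w_{n+1}=\mathcal C_n(w_n,w_n,\dots,w_n)$ ($k_n$ entries). $\mathcal K$ is the set of $x\in\{*,b,e\}^{\mathbb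 Z}$ every finite block of which occurs as a subword of some $w_n$, with shift $sh(x)(n)=x(n+1)$. *)

theory Defs
  imports "HOL-Probability.Probability" "HOL-Library.Sublist" "HOL-Number_Theory.Cong"
begin

section \<open>Alphabet {*, b, e} with the discrete topology\<close>

datatype sym = Star | Bsym | Esym

instantiation sym :: topological_space
begin
definition open_sym :: "sym set \<Rightarrow> bool" where "open_sym S = True"
instance by standard (auto simp: open_sym_def)
end

section \<open>The circular operator\<close>

text \<open>j_i: the unique j in {0..q-1} with j = p^{-1} i mod q, i.e. p*j = i mod q.\<close>
definition circ_j :: "nat \<Rightarrow> nat \<Rightarrow> nat \<Rightarrow> nat" where
  "circ_j p q i = (THE j. j < q \<and> [p * j = i] (mod q))"

text \<open>C(w_0,...,w_{k-1}) = prod_{i<q} prod_{j<k} b^{q-j_i} w_j^{l-1} e^{j_i}\<close>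
definition circ_op :: "nat \<Rightarrow> nat \<Rightarrow> nat \<Rightarrow> nat \<Rightarrow> (nat \<Rightarrow> sym list) \<Rightarrow> sym list" where
  "circ_op k l p q w =
     concat (map (\<lambda>i. concat (map (\<lambda>j.
        replicate (q - circ_j p q i) Bsym @ concat (replicate (l - 1) (w j))
          @ replicate (circ_j p q i) Esym) [0..<k])) [0..<q])"

text \<open>Coefficients (p_n, q_n).\<close>
fun circ_pq :: "(nat \<Rightarrow> nat) \<Rightarrow> (nat \<Rightarrow> nat) \<Rightarrow> nat \<Rightarrow> nat \<times> nat" where
  "circ_pq k l 0 = (0, 1)"
| "circ_pq k l (Suc n) =
     (let (p, q) = circ_pq k l n in (p * q * k n * l n + 1, k n * l n * q ^ 2))"

definition circ_p :: "(nat \<Rightarrow> nat) \<Rightarrow> (nat \<Rightarrow> nat) \<Rightarrow> nat \<Rightarrow> nat" where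
  "circ_p k l n = fst (circ_pq k l n)"

definition circ_q :: "(nat \<Rightarrow> nat) \<Rightarrow> (nat \<Rightarrow> nat) \<Rightarrow> nat \<Rightarrow> nat" where
  "circ_q k l n = snd (circ_pq k l n)"

definition circ_alpha :: "(nat \<Rightarrow> nat) \<Rightarrow> (nat \<Rightarrow> nat) \<Rightarrow> nat \<Rightarrow> real" where
  "circ_alpha k l n = real (circ_p k l n) / real (circ_q k l n)"

text \<open>The words w_n: w_0 = *, w_{n+1} = C_n(w_n, ..., w_n).\<close>
fun circ_w :: "(nat \<Rightarrow> nat) \<Rightarrow> (nat \<Rightarrow> nat) \<Rightarrow> nat \<Rightarrow> sym list" where
  "circ_w k l 0 = [Star]"
| "circ_w k l (Suc n) =
     circ_op (k n) (l n) (circ_p k l n) (circ_q k l n) (\<lambda>_. circ_w k l n)"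

text \<open>The circle factor K and the shift.\<close>
definition circle_factor :: "(nat \<Rightarrow> nat) \<Rightarrow> (nat \<Rightarrow> nat) \<Rightarrow> (int \<Rightarrow> sym) set" where
  "circle_factor k l =
     {x. \<forall>a b. a \<le> b \<longrightarrow> (\<exists>n. sublist (map x [a..b]) (circ_w k l n))}"

definition sh :: "(int \<Rightarrow> sym) \<Rightarrow> (int \<Rightarrow> sym)" where
  "sh x = (\<lambda>n. x (n + 1))"

section \<open>Measure-preserving systems and isomorphism\<close>

definition measure_preserving_map :: "'a measure \<Rightarrow> ('a \<Rightarrow> 'a) \<Rightarrow> bool" where
  "measure_preserving_map M T \<longleftrightarrow> T \<in> measurable M M \<and> distr M M T = M"

text \<open>Measure-theoretic isomorphism of (M,T) and (N,S): there are full-measure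
  forward-invariant measurable sets X, Y and a bimeasurable bijection
  phi : X -> Y carrying M to N and intertwining T and S.\<close>
definition mt_isomorphic ::
  "'a measure \<Rightarrow> ('a \<Rightarrow> 'a) \<Rightarrow> 'b measure \<Rightarrow> ('b \<Rightarrow> 'b) \<Rightarrow> bool" where
  "mt_isomorphic M T N S \<longleftrightarrow>
     (\<exists>X Y \<phi>. X \<in> sets M \<and> Y \<in> sets N \<and>
        emeasure M (space M - X) = 0 \<and> emeasure N (space N - Y) = 0 \<and>
        T ` X \<subseteq> X \<and> S ` Y \<subseteq> Y \<and>
        bij_betw \<phi> X Y \<and>
        \<phi> \<in> measurable (restrict_space M X) (restrict_space N Y) \<and>
        the_inv_into X \<phi> \<in> measurable (restrict_space N Y) (restrict_space M X) \<and>
        distr (restrict_space M X) (restrict_space N Y) \<phi> = restrict_space N Y \<and>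
        (\<forall>x\<in>X. \<phi> (T x) = S (\<phi> x)))"

text \<open>Borel probability measures on K (K with the subspace topology of the
  product topology on {*,b,e}^Z) that are non-atomic and shift-invariant.\<close>
definition circle_measure :: "(nat \<Rightarrow> nat) \<Rightarrow> (nat \<Rightarrow> nat) \<Rightarrow> (int \<Rightarrow> sym) measure \<Rightarrow> bool" where
  "circle_measure k l \<nu> \<longleftrightarrow>
     prob_space \<nu> \<and>
     space \<nu> = circle_factor k l \<and>
     sets \<nu> = sets (restrict_space borel (circle_factor k l)) \<and>
     (\<forall>x\<in>circle_factor k l. emeasure \<nu> {x} = 0) \<and>
     measure_preserving_map \<nu> sh"

text \<open>Circle [0,1) with Lebesgue measure and rotation.\<close>
definition circle_lebesgue :: "real measure" where
  "circle_lebesgue = restrict_space lborel {0..<1}"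

definition rot :: "real \<Rightarrow> real \<Rightarrow> real" where
  "rot \<alpha> x = frac (x + \<alpha>)"

end

theory Submission
  imports Defs
begin

text \<open>
  Since \<open>\<alpha>\<^sub>n\<^sub>+\<^sub>1 = \<alpha>\<^sub>n + 1/q\<^sub>n\<^sub>+\<^sub>1\<close>, the limit \<open>\<alpha>\<close> exists and is of Liouville type.
  The letter \<open>w\<^sub>n(t)\<close> is attached to the interval of length \<open>1/q\<^sub>n\<close> with left end point
  \<open>p\<^sub>n t/q\<^sub>n mod 1\<close>, so every \<open>\<theta>\<close> in the circle has a position \<open>t\<^sub>n(\<theta>)\<close> in \<open>w\<^sub>n\<close>, and the numbers
  \<open>j\<^sub>i\<close> in the circular operator are exactly what makes positions at consecutive stages compatible.
  By Borel-Cantelli (this is where \<open>\<Sum>1/l\<^sub>n < \<infinity>\<close> enters) almost every \<open>\<theta>\<close> lies deep inside a block of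
  copies of \<open>w\<^sub>n\<close> for all large \<open>n\<close>; hence the words around \<open>t\<^sub>n(\<theta>)\<close> converge to a point of the circle
  factor, and \<open>\<theta>\<close> can be read off from that point because the cyclic rotations of \<open>w\<^sub>n\<close> are pairwise
  distinct. This gives the isomorphism for the image of Lebesgue measure.

  For uniqueness, a point of the circle factor is, for large \<open>n\<close>, a concatenation of copies of \<open>w\<^sub>n\<close>
  separated by spacers of the form \<open>e\<^sup>c b\<^sup>d\<close>. A non-atomic invariant measure charges long spacers
  arbitrarily little, so the measure of an event depending on finitely many coordinates is
  approximated by its frequency in the periodic repetition of \<open>w\<^sub>n\<close>, which does not depend on the measure.
\<close>

subsection \<open>The circular words\<close>

text \<open>An inverse of p modulo q gives existence, and cancelling p gives uniqueness, so the
  definite description in \<open>circ_j\<close> denotes.\<close>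

lemma circ_j_props:
  assumes "coprime p q" "q > 0"
  shows "circ_j p q i < q" "[p * circ_j p q i = i] (mod q)"
proof -
  obtain x where x: "[p * x = 1] (mod q)"
    using cong_solve_coprime_nat[OF assms(1)] by auto
  have "[p * (x * i) = 1 * i] (mod q)"
    using cong_scalar_right[OF x, of i] by (simp add: mult.assoc)
  hence "[p * ((x * i) mod q) = i] (mod q)"
    by (simp add: cong_def mod_mult_right_eq)
  moreover have "(x * i) mod q < q" using assms(2) by simp
  moreover have "y = z" if "y < q \<and> [p * y = i] (mod q)" "z < q \<and> [p * z = i] (mod q)" for y z
  proof -
    have "[p * y = p * z] (mod q)" using that cong_trans cong_sym by blast
    hence "[y = z] (mod q)" using assms(1) by (simp add: cong_mult_lcancel_nat)
    thus ?thesis using that by (simp add: cong_def)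
  qed
  ultimately have "\<exists>!y. y < q \<and> [p * y = i] (mod q)" by blast
  from theI'[OF this] show "circ_j p q i < q" "[p * circ_j p q i = i] (mod q)"
    unfolding circ_j_def by auto
qed

lemma circ_j_eqI:
  assumes "coprime p q" "j < q" "[p * j = i] (mod q)"
  shows "circ_j p q i = j"
proof -
  have "q > 0" using assms(2) by simp
  note c = circ_j_props[OF assms(1) this, of i]
  have "[p * circ_j p q i = p * j] (mod q)" using c(2) assms(3) cong_trans cong_sym by blast
  hence "[circ_j p q i = j] (mod q)" using assms(1) by (simp add: cong_mult_lcancel_nat)
  thus ?thesis using c(1) assms(2) by (simp add: cong_def)
qed

section \<open>Lengths and letters of concatenations of equally long words\<close>

lemma length_concat_uniform:
  assumes "\<And>x. x \<in> set xs \<Longrightarrow> length (f x) = L"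
  shows "length (concat (map f xs)) = length xs * L"
  using assms by (induction xs) auto

lemma nth_concat_uniform:
  assumes "\<And>i. i < n \<Longrightarrow> length (f i) = L" "t < n * L"
  shows "concat (map f [0..<n]) ! t = f (t div L) ! (t mod L)"
  using assms
proof (induction n)
  case (Suc n)
  have len: "length (concat (map f [0..<n])) = n * L"
    using length_concat_uniform[of "[0..<n]" f L] Suc.prems(1) by simp
  show ?case
  proof (cases "t < n * L")
    case True
    thus ?thesis using Suc len by (simp add: nth_append)
  next
    case False
    have "t = n * L + (t - n * L)" "t - n * L < L" using False Suc.prems(2) by auto
    hence "t div L = n" "t mod L = t - n * L"
      by (metis add.commute add.right_neutral add_cancel_left_left div_less div_mult_self3
            less_nat_zero_code mult.commute mult_zero_right gr_implies_not0)
         (metis \<open>t = n * L + (t - n * L)\<close> \<open>t - n * L < L\<close> mod_less mod_mult_self3)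
    thus ?thesis using False len by (simp add: nth_append)
  qed
qed simp

lemma nth_concat_replicate:
  assumes "t < n * length v"
  shows "concat (replicate n v) ! t = v ! (t mod length v)"
proof -
  have "concat (replicate n v) = concat (map (\<lambda>_. v) [0..<n])"
    by (simp add: map_replicate_const)
  thus ?thesis using nth_concat_uniform[of n "\<lambda>_. v" "length v" t] assms by simp
qed

text \<open>The spacers before and after the copies have total length \<open>b\<close> whatever i
  is, so every factor has length \<open>l' * b\<close>.\<close>

lemma length_circ_op:
  assumes "\<And>i. i < b \<Longrightarrow> circ_j a b i < b" "\<And>i. length (v i) = b" "l' \<ge> 1"
  shows "length (circ_op k' l' a b v) = b * (k' * (l' * b))"
proof -
  have "length (concat (replicate r xs)) = r * length xs" for r and xs :: "sym list"
    by (induction r) auto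
  moreover have "b - circ_j a b i + ((l' - 1) * b + circ_j a b i) = l' * b" if "i < b" for i
    using assms(1)[OF that] assms(3) by (cases l') auto
  ultimately show ?thesis
    unfolding circ_op_def
    by (subst length_concat_uniform[where L="k' * (l' * b)"])
       (auto simp: assms(2) length_concat_uniform[where L="l' * b"])
qed

section \<open>Arithmetic of the coefficients and letters of the words\<close>

locale circ_seq =
  fixes k l :: "nat \<Rightarrow> nat"
  assumes k2: "\<And>n. k n \<ge> 2"
    and lpos: "\<And>n. l n \<ge> 1"
    and lsum: "summable (\<lambda>n. 1 / real (l n))"
begin

abbreviation "p \<equiv> circ_p k l"
abbreviation "q \<equiv> circ_q k l"
abbreviation "w \<equiv> circ_w k l"

lemma pq_0 [simp]: "p 0 = 0" "q 0 = 1"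
  by (simp_all add: circ_p_def circ_q_def)

lemma p_Suc: "p (Suc n) = p n * q n * k n * l n + 1"
  by (simp add: circ_p_def circ_q_def Let_def case_prod_unfold)

lemma q_Suc: "q (Suc n) = k n * l n * (q n)\<^sup>2"
  by (simp add: circ_q_def Let_def case_prod_unfold)

lemma q_pos [simp]: "q n > 0"
proof (induction n)
  case (Suc n)
  thus ?case using k2[of n] lpos[of n] by (simp add: q_Suc)
qed simp

lemma q_nonzero [simp]: "q n \<noteq> 0" "Suc 0 \<le> q n"
  using q_pos[of n] by (auto simp del: q_pos)

text \<open>The new numerator is 1 plus a multiple of \<open>k m * l m * q m\<close>, and the new
  denominator is this number times \<open>q m\<close>.\<close>

lemma coprime_pq: "coprime (p n) (q n)"
proof (cases n)
  case (Suc m)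
  let ?a = "k m * l m * q m"
  have "coprime (p m * ?a + 1) ?a" 
    by (metis coprime_1_left coprime_iff_gcd_eq_1 gcd.commute gcd_add_mult mult.commute add.commute)
  hence c: "coprime (p (Suc m)) ?a" by (simp add: p_Suc algebra_simps)
  hence "coprime (p (Suc m)) (?a * q m)" by (simp add: coprime_mult_right_iff)
  thus ?thesis by (simp add: Suc q_Suc power2_eq_square algebra_simps)
qed simp

lemma q_Suc_ge: "q (Suc n) \<ge> 2 * (q n)\<^sup>2"
proof -
  have "2 * 1 \<le> k n * l n" by (intro mult_le_mono k2 lpos)
  thus ?thesis unfolding q_Suc by (intro mult_le_mono) auto
qed

lemma q_Suc_ge2: "q (Suc n) \<ge> 2 * q n"
proof -
  have "q n \<le> (q n)\<^sup>2" using q_pos[of n] by (simp add: power2_eq_square Suc_leI)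
  thus ?thesis using q_Suc_ge[of n] by simp
qed

lemma q_ge_pow: "q n \<ge> 2 ^ n"
proof (induction n)
  case (Suc n)
  thus ?case using q_Suc_ge2[of n] by simp
qed simp

lemma q_ge: "q n \<ge> n"
  by (rule le_trans[OF less_imp_le[OF less_exp] q_ge_pow])

lemma q_mono: "m \<le> n \<Longrightarrow> q m \<le> q n"
  
proof (erule lift_Suc_mono_le[rotated])
  show "q n \<le> q (Suc n)" for n using q_Suc_ge2[of n] by simp
qed

abbreviation "inv_p n i \<equiv> circ_j (p n) (q n) i"

lemmas inv_p = circ_j_props[OF coprime_pq q_pos]
lemmas inv_pI = circ_j_eqI[OF coprime_pq]

lemma length_w: "length (w n) = q n"
proof (induction n)
  case (Suc n)
  show ?case using length_circ_op[of "q n" "p n" "\<lambda>_. w n" "l n" "k n"] inv_p(1)[of n] Suc lpos[of n]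
    by (simp add: q_Suc power2_eq_square algebra_simps)
qed simp

text \<open>Here i numbers the outer product and u is the offset inside a factor of length
  \<open>l n * q n\<close>. The copies of \<open>w n\<close> start at offset
  \<open>q n - inv_p n i\<close>, so the position inside a copy is u plus \<open>inv_p n i\<close>
  modulo \<open>q n\<close>.\<close>

lemma nth_w_Suc:
  fixes n t
  defines "u \<equiv> t mod (l n * q n)" and "i \<equiv> t div (k n * (l n * q n))"
  assumes t: "t < q (Suc n)"
  shows "i < q n"
    and "w (Suc n) ! t = (if u < q n - inv_p n i then Bsym
       else if u < l n * q n - inv_p n i then w n ! ((u + inv_p n i) mod q n) else Esym)"
proof -
  let ?lq = "l n * q n"
  have lq: "?lq > 0" "k n > 0" using lpos[of n] k2[of n] by auto
  have t': "t < q n * (k n * ?lq)"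
    using t by (simp add: q_Suc power2_eq_square algebra_simps)
  thus i: "i < q n" using lq by (simp add: i_def less_mult_imp_div_less)
  define f where "f i = replicate (q n - inv_p n i) Bsym @ concat (replicate (l n - 1) (w n))
          @ replicate (inv_p n i) Esym" for i
  have lrep: "length (concat (replicate r xs)) = r * length xs" for r and xs :: "sym list"
    by (induction r) auto
  have lf: "length (f i) = ?lq" for i
    using inv_p(1)[of n i] lpos[of n] by (cases "l n") (auto simp: f_def lrep length_w)
  have len2: "length (concat (map (\<lambda>j. f i) [0..<k n])) = k n * ?lq" for i
    using length_concat_uniform[of "[0..<k n]" "\<lambda>j. f i" ?lq] lf by simp
  have "w (Suc n) ! t = concat (map (\<lambda>i. concat (map (\<lambda>j. f i) [0..<k n])) [0..<q n]) ! t"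
    by (simp add: circ_op_def f_def)
  also have "\<dots> = concat (map (\<lambda>j. f i) [0..<k n]) ! (t mod (k n * ?lq))"
    unfolding i_def by (rule nth_concat_uniform[OF len2 t'])
  also have "\<dots> = f i ! (t mod (k n * ?lq) mod ?lq)"
    by (rule nth_concat_uniform) (use lf lq in auto)
  also have "t mod (k n * ?lq) mod ?lq = u" by (simp add: u_def mod_mod_cancel)
  finally have 1: "w (Suc n) ! t = f i ! u" .
  have u: "u < ?lq" using lq by (simp add: u_def)
  have j: "inv_p n i < q n" by (rule inv_p(1))
  have lq1: "(l n - 1) * q n = ?lq - q n" by (simp add: diff_mult_distrib)
  have lq2: "?lq \<ge> q n" using lpos[of n] by simp
  consider "u < q n - inv_p n i" | "u \<ge> q n - inv_p n i" "u < ?lq - inv_p n i" | "u \<ge> ?lq - inv_p n i" by linarith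
  thus "w (Suc n) ! t = (if u < q n - inv_p n i then Bsym
       else if u < ?lq - inv_p n i then w n ! ((u + inv_p n i) mod q n) else Esym)"
  proof cases
    case 1
    thus ?thesis using \<open>w (Suc n) ! t = f i ! u\<close> by (simp add: f_def nth_append)
  next
    case 2
    let ?v = "u - (q n - inv_p n i)"
    have v: "?v < (l n - 1) * length (w n)" using 2 j lq1 lq2 by (simp add: length_w)
    have "f i ! u = concat (replicate (l n - 1) (w n)) ! ?v"
      using 2 v by (simp add: f_def nth_append lrep length_w)
    also have "\<dots> = w n ! (?v mod q n)" using nth_concat_replicate[OF v] by (simp add: length_w)
    \<comment> \<open>Adding one full period removes the subtraction in \<open>?v\<close>.\<close>
    also have "?v mod q n = (?v + q n) mod q n" by simp
    also have "?v + q n = u + inv_p n i" using 2 j by simp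
    finally show ?thesis using 2 1 by simp
  next
    case 3
    have nu: "\<not> u < q n - inv_p n i" using diff_le_mono[OF lq2, of "inv_p n i"] 3 by linarith
    hence "f i ! u = Esym" using 3 j u lq1 lq2 by (auto simp: f_def nth_append lrep length_w)
    thus ?thesis using 1 nu 3 by simp
  qed
qed

end

declare circ_w.simps(2) [simp del]

subsection \<open>Parsing into words and spacers\<close>

text \<open>Letters b are only added in front and letters e only behind, so the gap between
  consecutive copies of v has the form e...eb...b. Because of this shape a half-line without copies
  is eventually constant.\<close>

inductive spaced :: "sym list \<Rightarrow> sym list \<Rightarrow> bool" for v where
  base: "spaced v v"
| begin_sp: "spaced v x \<Longrightarrow> spaced v (Bsym # x)"
| end_sp: "spaced v x \<Longrightarrow> spaced v (x @ [Esym])"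
| append: "spaced v x \<Longrightarrow> spaced v y \<Longrightarrow> spaced v (x @ y)"

lemma spaced_replicate_B: "spaced v x \<Longrightarrow> spaced v (replicate a Bsym @ x)"
  by (induction a) (auto intro: spaced.begin_sp)

lemma spaced_replicate_E: "spaced v x \<Longrightarrow> spaced v (x @ replicate a Esym)"
proof (induction a)
  case (Suc a)
  have "x @ replicate (Suc a) Esym = (x @ replicate a Esym) @ [Esym]"
    by (simp add: replicate_append_same)
  thus ?case using Suc by (metis spaced.end_sp)
qed simp

lemma spaced_concat: "xs \<noteq> [] \<Longrightarrow> (\<And>x. x \<in> set xs \<Longrightarrow> spaced v x) \<Longrightarrow> spaced v (concat xs)"
proof (induction xs rule: list_nonempty_induct)
  case (cons x xs)
  thus ?case by (auto intro: spaced.append)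
qed simp

text \<open>A letter is labelled with its position inside a copy of v, or with None if it is a spacer.\<close>

definition label_ok :: "sym list \<Rightarrow> sym \<times> nat option \<Rightarrow> bool" where
  "label_ok v a = (case snd a of None \<Rightarrow> fst a \<noteq> Star | Some r \<Rightarrow> r < length v \<and> fst a = v ! r)"

text \<open>A condition on neighbouring letters only, so that it is inherited by every window of an
  infinite sequence. Forbidding b before e inside a gap expresses the shape of the gaps.\<close>

definition label_step :: "sym list \<Rightarrow> sym \<times> nat option \<Rightarrow> sym \<times> nat option \<Rightarrow> bool" where
  "label_step v a b = (case snd a of
     Some r \<Rightarrow> (if Suc r < length v then snd b = Some (Suc r) else snd b = None \<or> snd b = Some 0)
   | None \<Rightarrow> (case snd b of None \<Rightarrow> \<not> (fst a = Bsym \<and> fst b = Esym) | Some r \<Rightarrow> r = 0))"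

text \<open>The conditions on the first and last entries carry the induction through
  \<open>append\<close>: a word ends with a gap letter e or the end of a copy, the next one begins
  with a gap letter b or the start of a copy, and all four junctions are admissible.\<close>

lemma spaced_labels:
  assumes "spaced v x" "v \<noteq> []"
  shows "\<exists>V. map fst V = x \<and> V \<noteq> [] \<and> successively (label_step v) V \<and> list_all (label_ok v) V
    \<and> (hd V = (Bsym, None) \<or> snd (hd V) = Some 0)
    \<and> (last V = (Esym, None) \<or> snd (last V) = Some (length v - 1))"
  using assms(1)
proof induction
  case base
  let ?V = "zip v (map Some [0..<length v])"
  have "successively (label_step v) ?V"
    by (auto simp: successively_conv_nth label_step_def)
  moreover have "hd ?V = ?V ! 0" "last ?V = ?V ! (length v - 1)"
    using assms(2) by (auto simp: hd_conv_nth last_conv_nth)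
  ultimately show ?case using assms(2)
    by (intro exI[of _ ?V]) (auto simp: list_all_length label_ok_def)
next
  case (begin_sp x)
  then obtain V where V: "map fst V = x" "V \<noteq> []" "successively (label_step v) V" "list_all (label_ok v) V"
    "hd V = (Bsym, None) \<or> snd (hd V) = Some 0" "last V = (Esym, None) \<or> snd (last V) = Some (length v - 1)"
    by blast
  have "label_step v (Bsym, None) (hd V)" using V(5) by (auto simp: label_step_def)
  moreover have "label_ok v (Bsym, None)" by (simp add: label_ok_def)
  ultimately show ?case using V
    by (intro exI[of _ "(Bsym, None) # V"]) (auto simp: successively_Cons)
next
  case (end_sp x)
  then obtain V where V: "map fst V = x" "V \<noteq> []" "successively (label_step v) V" "list_all (label_ok v) V"
    "hd V = (Bsym, None) \<or> snd (hd V) = Some 0" "last V = (Esym, None) \<or> snd (last V) = Some (length v - 1)"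
    by blast
  have "label_step v (last V) (Esym, None)" using V(6) assms(2) by (auto simp: label_step_def)
  moreover have "label_ok v (Esym, None)" by (simp add: label_ok_def)
  ultimately show ?case using V
    by (intro exI[of _ "V @ [(Esym, None)]"]) (auto simp: successively_append_iff)
next
  case (append x y)
  then obtain V where V: "map fst V = x" "V \<noteq> []" "successively (label_step v) V" "list_all (label_ok v) V"
    "hd V = (Bsym, None) \<or> snd (hd V) = Some 0" "last V = (Esym, None) \<or> snd (last V) = Some (length v - 1)"
    by blast
  from append obtain U where U: "map fst U = y" "U \<noteq> []" "successively (label_step v) U" "list_all (label_ok v) U"
    "hd U = (Bsym, None) \<or> snd (hd U) = Some 0" "last U = (Esym, None) \<or> snd (last U) = Some (length v - 1)"
    by blast
  have "label_step v (last V) (hd U)"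
    using V(6) U(5) assms(2) by (auto simp: label_step_def split: option.splits)
  thus ?case using V U
    by (intro exI[of _ "V @ U"]) (auto simp: successively_append_iff)
qed

context circ_seq begin

text \<open>With \<open>l i\<close> at least 2 every factor of the circular operator contains a copy
  of the previous word between its spacers, so the shape is preserved from stage to stage.\<close>

lemma w_spaced:
  assumes "\<And>i. i \<ge> n \<Longrightarrow> l i \<ge> 2" "n \<le> m"
  shows "spaced (w n) (w m)"
  using assms(2)
proof (induction m rule: dec_induct)
  case (step m)
  have "spaced (w n) (concat (replicate (l m - 1) (w m)))"
    using step assms(1)[of m] by (intro spaced_concat) auto
  hence "spaced (w n) (replicate (q m - inv_p m i) Bsym @ concat (replicate (l m - 1) (w m))
          @ replicate (inv_p m i) Esym)" for i
    by (intro spaced_replicate_B spaced_replicate_E)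
  thus ?case using k2[of m] q_pos[of m] unfolding circ_w.simps circ_op_def
    by (intro spaced_concat) (auto intro!: spaced_concat)
qed (rule spaced.base)

text \<open>The window occurs in some \<open>w m\<close> with m at least n, and the labels of that
  word by positions in \<open>w n\<close> are restricted to the window.\<close>

lemma K_labels:
  assumes x: "x \<in> circle_factor k l" and l2: "\<And>i. i \<ge> n \<Longrightarrow> l i \<ge> 2"
  obtains lab :: "int \<Rightarrow> nat option" where
    "\<And>t. a \<le> t \<Longrightarrow> t \<le> b \<Longrightarrow> label_ok (w n) (x t, lab t)"
    "\<And>t. a \<le> t \<Longrightarrow> t < b \<Longrightarrow> label_step (w n) (x t, lab t) (x (t + 1), lab (t + 1))"
proof -
  \<comment> \<open>Lengthening the window beyond \<open>q n\<close> forces the surrounding word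
    \<open>w m\<close> to be longer than \<open>w n\<close>, hence m > n.\<close>
  define c where "c = max b (a + int (q n))"
  have c: "b \<le> c" "a + int (q n) \<le> c" by (auto simp: c_def)
  obtain m where m: "sublist (map x [a..c]) (w m)"
    using x c unfolding circle_factor_def by force
  then obtain us vs where uv: "w m = us @ map x [a..c] @ vs" by (auto simp: sublist_def)
  have "length (map x [a..c]) > q n" using c by simp
  hence "q m > q n" using uv length_w[of m] by (metis length_append less_le_trans le_add1 le_add2 le_trans)
  hence "n \<le> m" using q_mono by (metis linorder_not_le less_imp_le_nat)
  from w_spaced[OF l2 this] have "spaced (w n) (w m)" .
  moreover have "w n \<noteq> []" using length_w[of n] q_pos[of n] by auto
  ultimately obtain V where V: "map fst V = w m" "successively (label_step (w n)) V"
    "list_all (label_ok (w n)) V" using spaced_labels by blast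
  define pos where "pos t = length us + nat (t - a)" for t
  define lab where "lab t = snd (V ! pos t)" for t
  have lV: "length V = length us + nat (c - a + 1) + length vs"
    using arg_cong[OF V(1), of length] uv by simp
  have el: "V ! pos t = (x t, lab t)" "pos t < length V" if "a \<le> t" "t \<le> c" for t
  proof -
    show pl: "pos t < length V" using that lV by (auto simp: pos_def)
    have "fst (V ! pos t) = w m ! pos t" using pl V(1) by (metis nth_map)
    also have "\<dots> = x t" using that unfolding uv pos_def by (simp add: nth_append nth_upto)
    finally show "V ! pos t = (x t, lab t)" by (simp add: lab_def prod_eq_iff)
  qed
  show ?thesis
  proof (rule that[of lab])
    fix t assume t: "a \<le> t" "t \<le> b"
    have "t \<le> c" using t c by linarith
    thus "label_ok (w n) (x t, lab t)"
      using V(3) el[OF t(1)] by (simp add: list_all_length) metis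
  next
    fix t assume t: "a \<le> t" "t < b"
    have t': "t \<le> c" "t + 1 \<le> c" "a \<le> t + 1" using t c by linarith+
    have "pos (t + 1) = Suc (pos t)" using t by (simp add: pos_def nat_diff_distrib nat_add_distrib Suc_nat_eq_nat_zadd1 algebra_simps)
    thus "label_step (w n) (x t, lab t) (x (t + 1), lab (t + 1))"
      using V(2) el[OF t(1) t'(1)] el[OF t'(3,2)] by (simp add: successively_conv_nth) metis
  qed
qed

subsection \<open>Aperiodicity of the words\<close>

text \<open>The last factor has i = \<open>q m - 1\<close>, which is nonzero modulo
  \<open>q m\<close> because \<open>q m\<close> is at least 2. Its trailing spacer is therefore
  nonempty. The bound on n excludes m = 0, where \<open>q 0 = 1\<close>.\<close>

lemma w_last:
  assumes "n \<ge> 2" shows "w n ! (q n - 1) = Esym"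
proof -
  obtain m where m: "n = Suc m" "m \<ge> 1" using assms by (cases n) auto
  let ?lq = "l m * q m"
  let ?t = "q n - 1"
  have q2: "q m \<ge> 2" 
    by (rule le_trans[OF _ q_mono[OF m(2)]]) (use q_Suc_ge2[of 0] in simp)
  have pos: "?lq > 0" "k m > 0" "k m * ?lq > 0" using lpos[of m] k2[of m] by auto
  have Q: "q n = (k m * q m) * ?lq" "q n = q m * (k m * ?lq)"
    by (simp_all add: m(1) q_Suc power2_eq_square algebra_simps)
  have sub1: "(a * b - 1) div b = a - 1 \<and> (a * b - 1) mod b = b - 1" if "a > 0" "b > 0" for a b :: nat
  proof -
    have "a * b - 1 = (a - 1) * b + (b - 1)" using that by (cases a) auto
    moreover have "((a - 1) * b + (b - 1)) div b = a - 1" "((a - 1) * b + (b - 1)) mod b = b - 1"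
      using that by (simp_all del: One_nat_def add_diff_assoc)
    ultimately show ?thesis by simp
  qed
  have u: "?t mod ?lq = ?lq - 1" using sub1[of "k m * q m" ?lq] pos Q(1) by simp
  have i: "?t div (k m * ?lq) = q m - 1" using sub1[of "q m" "k m * ?lq"] pos Q(2) by simp
  have j: "inv_p m (q m - 1) \<noteq> 0"
  proof
    assume "inv_p m (q m - 1) = 0"
    hence "[0 = q m - 1] (mod q m)" using inv_p(2)[of m "q m - 1"] by simp
    thus False using q2 by (simp add: cong_def)
  qed
  have "?t < q (Suc m)" using m by simp
  from nth_w_Suc(2)[OF this] have "w n ! ?t = (if ?lq - 1 < q m - inv_p m (q m - 1) then Bsym
       else if ?lq - 1 < ?lq - inv_p m (q m - 1) then w m ! ((?lq - 1 + inv_p m (q m - 1)) mod q m) else Esym)"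
    by (simp only: m(1)[symmetric] u i)
  moreover have "\<not> ?lq - 1 < ?lq - inv_p m (q m - 1)" using j by linarith
  moreover have "q m \<le> ?lq" using lpos[of m] by simp
  hence "\<not> ?lq - 1 < q m - inv_p m (q m - 1)" using j by linarith
  ultimately show ?thesis by simp
qed

text \<open>The cyclic word begins with a run of the letter b that is longer than every run of b
  inside the blocks with i > 0; some multiple of a putative period falls into such a block.\<close>

lemma w_aperiodic:
  assumes n: "n \<ge> 2" and l2: "l n \<ge> 2" and d: "0 < d" "d < q (Suc n)"
    and periodic: "\<And>s. w (Suc n) ! ((s + d) mod q (Suc n)) = w (Suc n) ! (s mod q (Suc n))"
  shows False
proof -
  let ?q = "q n" and ?lq = "l n * q n" and ?Q = "q (Suc n)"
  \<comment> \<open>The length of the initial run of b in \<open>w n\<close>.\<close>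
  define f where "f = (LEAST f. w n ! f \<noteq> Bsym)"
  have "w n ! (?q - 1) \<noteq> Bsym" using w_last[OF n] by simp
  hence f: "w n ! f \<noteq> Bsym" "f \<le> ?q - 1" unfolding f_def by (rule LeastI, rule Least_le)
  have fmin: "w n ! i = Bsym" if "i < f" for i using that not_less_Least f_def by blast
  have fq: "f < ?q" using f(2) q_pos[of n] by linarith
  have lq2: "2 * ?q \<le> ?lq" using l2 by simp
  have pos: "?lq > 0" "k n > 0" "k n * ?lq > 0" using lpos[of n] k2[of n] by auto
  have Q: "?Q = ?q * (k n * ?lq)" by (simp add: q_Suc power2_eq_square algebra_simps)
  have klq: "?lq \<le> k n * ?lq" using k2[of n] by simp
  have lqQ: "k n * ?lq \<le> ?Q" using Q by simp
  have q2: "?q \<ge> 2" using q_ge[of n] n by linarith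
  \<comment> \<open>The factor with i = 0 has \<open>inv_p n 0 = 0\<close>, so it begins with
    \<open>q n\<close> spacers b, which are prolonged by the f letters b at the start of
    \<open>w n\<close>.\<close>
  have start: "w (Suc n) ! s = Bsym" if "s < ?q + f" for s
  proof -
    have s: "s < ?lq" "s < ?Q" "s < k n * ?lq" using that fq lq2 klq lqQ by linarith+
    have j0: "inv_p n 0 = 0" by (rule inv_pI) auto
    have "\<not> s < ?q \<Longrightarrow> w n ! (s mod ?q) = Bsym"
      using that fmin[of "s - ?q"] fq by (simp add: mod_if[of s])
    thus ?thesis using nth_w_Suc(2)[OF s(2)] s j0 by simp
  qed
  \<comment> \<open>From any position in a block with i > 0, a letter other than b is met before
    \<open>q n + f\<close> steps. The three cases are a start in the leading spacer, in the copies,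
    and in the trailing spacer.\<close>
  have later: "\<exists>s < ?q + f. T + s < ?Q \<and> w (Suc n) ! (T + s) \<noteq> Bsym" if T: "k n * ?lq \<le> T" "T < ?Q" for T
  proof -
    define u i where "u = T mod ?lq" and "i = T div (k n * ?lq)"
    have i1: "i \<ge> 1" using T(1) pos div_le_mono[OF T(1), of "k n * ?lq"] by (simp add: i_def)
    have iq: "i < ?q" using nth_w_Suc(1)[OF T(2)] by (simp add: i_def)
    define j where "j = inv_p n i"
    have jq: "j < ?q" unfolding j_def by (rule inv_p)
    have j1: "j \<noteq> 0"
    proof
      assume "j = 0"
      hence "[0 = i] (mod ?q)" using inv_p(2)[of n i] by (simp add: j_def)
      thus False using iq i1 by (simp add: cong_def)
    qed
    have same: "(T + s) mod ?lq = u + s" "(T + s) div (k n * ?lq) = i" "T + s < ?Q" if "u + s < ?lq" for s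
    proof -
      define D where "D = T div ?lq"
      have Ts: "T + s = D * ?lq + (u + s)"
        unfolding D_def u_def by (simp only: add.assoc[symmetric] div_mult_mod_eq)
      have dT: "(T + s) div ?lq = D" unfolding Ts using that pos by (subst div_mult_self3) auto
      show "(T + s) mod ?lq = u + s" unfolding Ts using that by simp
      show i': "(T + s) div (k n * ?lq) = i"
        using dT unfolding D_def by (metis i_def div_mult2_eq mult.commute)
      have "T + s < (i + 1) * (k n * ?lq)" using i' pos
        by (metis dividend_less_div_times mult.commute Suc_eq_plus1 mult_Suc add.commute)
      also have "\<dots> \<le> ?q * (k n * ?lq)" using iq by (intro mult_le_mono) auto
      finally show "T + s < ?Q" using Q by simp
    qed
    have val: "w (Suc n) ! (T + s) = (if u + s < ?q - j then Bsym
       else if u + s < ?lq - j then w n ! ((u + s + j) mod ?q) else Esym)" if "u + s < ?lq" for s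
      using nth_w_Suc(2)[OF same(3)[OF that]] unfolding same(1,2)[OF that] j_def .
    have ulq: "u < ?lq" using pos by (simp add: u_def)
    consider "u < ?q - j" | "\<not> u < ?q - j" "u < ?lq - j" | "\<not> u < ?q - j" "\<not> u < ?lq - j" by blast
    thus ?thesis
    proof cases
      \<comment> \<open>The rest of the leading spacer and the f initial letters of the copy are
        passed; the count stays below \<open>q n + f\<close> because j > 0.\<close>
      case 1
      let ?s = "?q - j - u + f"
      have us: "u + ?s = ?q - j + f" using 1 by simp
      have lt: "u + ?s < ?lq" "u + ?s < ?lq - j" "\<not> u + ?s < ?q - j" using us fq lq2 jq by linarith+
      have "u + ?s + j = ?q + f" using us jq by simp
      hence "w (Suc n) ! (T + ?s) = w n ! f" using val[OF lt(1)] lt fq by simp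
      moreover have "?s < ?q + f" using j1 1 by linarith
      ultimately show ?thesis using f(1) same(3)[OF lt(1)] by metis
    next
      \<comment> \<open>The last letter of the current copy is e, and it is less than
        \<open>q n\<close> steps away.\<close>
      case 2
      define r where "r = (u + j) mod ?q"
      let ?s = "?q - 1 - r"
      have rq: "r < ?q" by (simp add: r_def)
      have ur: "u + j = (u + j) div ?q * ?q + r" by (simp add: r_def)
      have "u + j < ?lq" using 2 by linarith
      hence "(u + j) div ?q < l n" by (simp add: less_mult_imp_div_less)
      hence "((u + j) div ?q + 1) * ?q \<le> ?lq" by (intro mult_le_mono) auto
      moreover have eq: "u + ?s + j = (u + j) div ?q * ?q + (?q - 1)" using ur rq by linarith
      ultimately have lt: "u + ?s + j < ?lq" using q2 by (simp add: algebra_simps)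
      have m: "(u + ?s + j) mod ?q = ?q - 1" unfolding eq using q2 by (simp only: mod_mult_self3) simp
      have "u + ?s < ?lq" "\<not> u + ?s < ?q - j" "u + ?s < ?lq - j" using lt 2 by linarith+
      hence "w (Suc n) ! (T + ?s) = w n ! (?q - 1)" using val[of ?s] m by simp
      moreover have "?s < ?q + f" using q2 by linarith
      moreover have "T + ?s < ?Q" by (rule same(3)) (use lt in linarith)
      ultimately show ?thesis using w_last[OF n] by (intro exI[of _ ?s]) simp
    next
      case 3
      thus ?thesis using val[of 0] ulq T(2) q2 by (intro exI[of _ 0]) auto
    qed
  qed
  have mult: "w (Suc n) ! ((s + m * d) mod ?Q) = w (Suc n) ! (s mod ?Q)" for m s
  proof (induction m)
    case (Suc m)
    have "s + Suc m * d = (s + m * d) + d" by simp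
    thus ?case using periodic[of "s + m * d"] Suc by metis
  qed simp
  \<comment> \<open>For small d the first multiple beyond the block i = 0 is taken. It is less than
    two block lengths, and there are \<open>q n\<close>, at least 2, blocks.\<close>
  obtain m where m: "k n * ?lq \<le> m * d" "m * d < ?Q"
  proof (cases "d < k n * ?lq")
    case True
    let ?m = "k n * ?lq div d + 1"
    have "?m * d = k n * ?lq div d * d + d" by simp
    moreover have "k n * ?lq < k n * ?lq div d * d + d" using d(1)
      by (metis dividend_less_div_times add.commute)
    moreover have "k n * ?lq div d * d \<le> k n * ?lq" by simp
    moreover have "2 * (k n * ?lq) \<le> ?Q" unfolding Q using q2 by (intro mult_le_mono) auto
    ultimately show ?thesis using True by (intro that[of ?m]) linarith+
  next
    case False
    thus ?thesis using d by (intro that[of 1]) auto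
  qed
  from later[OF m] obtain s where s: "s < ?q + f" "m * d + s < ?Q" "w (Suc n) ! (m * d + s) \<noteq> Bsym" by blast
  have "w (Suc n) ! ((s + m * d) mod ?Q) = Bsym"
    using mult[of s m] start[OF s(1)] s(2) by simp
  thus False using s by (simp add: add.commute)
qed

text \<open>If two rotations agree, the difference of their starting positions is a period of the
  cyclic word, which \<open>w_aperiodic\<close> excludes.\<close>

lemma w_rotation_inj:
  assumes n: "n \<ge> 2" and l2: "l n \<ge> 2" and t: "t < q (Suc n)" "t' < q (Suc n)"
    and eq: "\<And>s. s < q (Suc n) \<Longrightarrow> w (Suc n) ! ((t + s) mod q (Suc n)) = w (Suc n) ! ((t' + s) mod q (Suc n))"
  shows "t = t'"
proof -
  let ?Q = "q (Suc n)"
  have *: False if t: "t < t'" "t' < ?Q"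
    and eq: "\<And>s. s < ?Q \<Longrightarrow> w (Suc n) ! ((t + s) mod ?Q) = w (Suc n) ! ((t' + s) mod ?Q)" for t t'
  proof (rule w_aperiodic[OF n l2, of "t' - t"])
    fix s
    \<comment> \<open>Chosen so that \<open>t + s'\<close> is congruent to s; then
      \<open>t' + s'\<close> is congruent to \<open>s + (t' - t)\<close>.\<close>
    define s' where "s' = (s + (?Q - t)) mod ?Q"
    have "(t + s') mod ?Q = (t + (s + (?Q - t))) mod ?Q" unfolding s'_def by (rule mod_add_right_eq)
    also have "t + (s + (?Q - t)) = s + ?Q" using t by simp
    finally have 1: "(t + s') mod ?Q = s mod ?Q" by simp
    have "(t' + s') mod ?Q = (t' + (s + (?Q - t))) mod ?Q" unfolding s'_def by (rule mod_add_right_eq)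
    also have "t' + (s + (?Q - t)) = (s + (t' - t)) + ?Q" using t by simp
    finally have 2: "(t' + s') mod ?Q = (s + (t' - t)) mod ?Q" by simp
    have "s' < ?Q" by (simp add: s'_def)
    from eq[OF this] show "w (Suc n) ! ((s + (t' - t)) mod ?Q) = w (Suc n) ! (s mod ?Q)"
      by (simp add: 1 2)
  qed (use t in auto)
  show ?thesis using *[of t t'] *[of t' t] t eq by (metis linorder_neqE_nat)
qed


subsection \<open>The limit rotation and its symbolic coding\<close>

abbreviation "al \<equiv> circ_alpha k l"

lemma al_Suc: "al (Suc n) = al n + 1 / real (q (Suc n))"
proof -
  have "real (k n) \<noteq> 0" "real (l n) \<noteq> 0" "real (q n) \<noteq> 0" using k2[of n] lpos[of n] by auto
  thus ?thesis by (simp add: circ_alpha_def p_Suc q_Suc field_simps power2_eq_square)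
qed

lemma al_eq_sum: "al n = (\<Sum>i<n. 1 / real (q (Suc i)))"
  by (induction n) (simp_all add: al_Suc, simp add: circ_alpha_def)

lemma q_Suc_add_ge: "q (Suc (i + n)) \<ge> 2 ^ i * q (Suc n)"
proof (induction i)
  case (Suc i)
  thus ?case using q_Suc_ge2[of "Suc (i + n)"] by simp
qed simp

lemma inverse_q_le: "1 / real (q (Suc (i + n))) \<le> (1 / 2) ^ i * (1 / real (q (Suc n)))"
proof -
  have "real (2 ^ i * q (Suc n)) \<le> q (Suc (i + n))" using q_Suc_add_ge[of i n] of_nat_le_iff by blast
  hence "1 / real (q (Suc (i + n))) \<le> 1 / real (2 ^ i * q (Suc n))"
    by (intro divide_left_mono) (auto intro!: mult_pos_pos)
  thus ?thesis by (simp add: power_divide)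
qed

lemma summable_inverse_q: "summable (\<lambda>i. 1 / real (q (Suc (i + n))))"
proof (rule summable_comparison_test')
  show "summable (\<lambda>i. (1 / 2) ^ i * (1 / real (q (Suc n))))"
    by (intro summable_mult2 summable_geometric) simp
qed (use inverse_q_le in auto)

definition alpha :: real where "alpha = (\<Sum>i. 1 / real (q (Suc i)))"

lemma al_tendsto: "al \<longlonglongrightarrow> alpha"
  using summable_LIMSEQ[OF summable_inverse_q[of 0]] by (simp add: alpha_def al_eq_sum[abs_def])

lemma alpha_diff: "alpha - al n = (\<Sum>i. 1 / real (q (Suc (i + n))))"
  using suminf_split_initial_segment[OF summable_inverse_q[of 0], of n] by (simp add: alpha_def al_eq_sum)

lemma alpha_diff_pos: "alpha - al n > 0"
  unfolding alpha_diff by (intro suminf_pos summable_inverse_q) simp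

text \<open>The denominators at least double at each stage, so the tail is dominated by a geometric
  series of ratio 1/2.\<close>

lemma alpha_diff_le: "alpha - al n \<le> 2 / real (q (Suc n))"
proof -
  have s: "(\<lambda>i. (1 / 2 :: real) ^ i * (1 / real (q (Suc n)))) sums (2 * (1 / real (q (Suc n))))"
    using geometric_sums[of "1 / 2 :: real"] by (intro sums_mult2) simp
  have "alpha - al n \<le> (\<Sum>i. (1 / 2 :: real) ^ i * (1 / real (q (Suc n))))"
    unfolding alpha_diff by (intro suminf_le summable_inverse_q inverse_q_le sums_summable[OF s])
  thus ?thesis using sums_unique[OF s] by simp
qed

text \<open>The quadratic growth of the denominators absorbs the constant 2. This makes the
  approximation good enough both for irrationality and for summing the carries.\<close>

lemma q_alpha_diff_le: "real (q n) * (alpha - al n) \<le> 1 / real (q n)"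
proof -
  have "real (q n) * (alpha - al n) \<le> real (q n) * (2 / real (q (Suc n)))" by (intro mult_left_mono alpha_diff_le) simp
  also have "\<dots> \<le> real (q n) * (2 / real (2 * (q n)\<^sup>2))"
    using q_Suc_ge[of n] by (intro mult_left_mono divide_left_mono) (auto simp del: of_nat_mult intro!: mult_pos_pos)
  also have "\<dots> = 1 / real (q n)" by (simp add: field_simps power2_eq_square)
  finally show ?thesis .
qed

text \<open>For a limit a/b the number b * \<open>q n\<close> * (\<open>alpha - al n\<close>) would
  be an integer, yet it is positive and at most b / \<open>q n\<close>.\<close>

lemma alpha_irrational: "alpha \<notin> \<rat>"
proof
  assume "alpha \<in> \<rat>"
  then obtain a :: int and b :: nat where ab: "alpha = a / b" "b > 0"
    by (metis Rats_cases' of_nat_0_less_iff zero_less_imp_eq_int of_int_of_nat_eq)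
  \<comment> \<open>Any index with \<open>q n\<close> > b works; \<open>q_ge\<close> provides this
    one.\<close>
  let ?n = "b + 1"
  let ?z = "a * int (q ?n) - int b * int (p ?n)"
  have "real b * (real (q ?n) * (alpha - al ?n)) = of_int ?z"
    using ab by (simp add: circ_alpha_def field_simps)
  moreover have "real b * (real (q ?n) * (alpha - al ?n)) > 0"
    using ab(2) alpha_diff_pos by simp
  moreover have "real b * (real (q ?n) * (alpha - al ?n)) \<le> real b * (1 / real (q ?n))"
    by (intro mult_left_mono q_alpha_diff_le) simp
  moreover have "real b * (1 / real (q ?n)) < 1"
  proof -
    have "real b < q ?n" using q_ge[of ?n] by linarith
    thus ?thesis by simp
  qed
  ultimately have "0 < (of_int ?z :: real)" "(of_int ?z :: real) < 1" by linarith+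
  hence "0 < ?z" "?z < 1" by (simp_all only: of_int_0_less_iff of_int_less_1_iff)
  thus False by linarith
qed

text \<open>\<open>level n \<theta>\<close> is the position in the n-th word whose interval contains \<open>\<theta>\<close>.\<close>

definition level :: "nat \<Rightarrow> real \<Rightarrow> nat" where
  "level n \<theta> = inv_p n (nat \<lfloor>real (q n) * \<theta>\<rfloor>)"

lemma level_less [simp]: "level n \<theta> < q n"
  by (simp add: level_def inv_p)

lemma level_cong: "0 \<le> \<theta> \<Longrightarrow> [int (p n) * int (level n \<theta>) = \<lfloor>real (q n) * \<theta>\<rfloor>] (mod int (q n))"
  using inv_p(2)[of n "nat \<lfloor>real (q n) * \<theta>\<rfloor>"]
  by (simp add: level_def flip: cong_int_iff)

lemma p_cancel: "[int (p n) * a = int (p n) * b] (mod int (q n)) \<Longrightarrow> [a = b] (mod int (q n))"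
  using cong_mult_lcancel[of "int (p n)" "int (q n)"] coprime_pq[of n] by simp

text \<open>Put K = \<open>k n * (l n * q n)\<close>, so that \<open>p (Suc n)\<close> is
  \<open>p n\<close> * K + 1 and \<open>q (Suc n)\<close> is \<open>q n\<close> * K. The integer
  part at stage n is the next one divided by K, which is \<open>p n\<close> * t + t div K modulo
  \<open>q n\<close>. Dividing by \<open>p n\<close> modulo \<open>q n\<close> turns t div K into
  the number j_i of the circular operator.\<close>

lemma level_Suc:
  fixes n \<theta>
  defines "t \<equiv> level (Suc n) \<theta>"
  assumes "0 \<le> \<theta>"
  shows "[int (level n \<theta>) = int t + int (inv_p n (t div (k n * (l n * q n))))] (mod int (q n))"
proof (rule p_cancel)
  let ?K = "k n * (l n * q n)"
  let ?i = "t div ?K"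
  have K: "?K > 0" using k2[of n] lpos[of n] by simp
  have Q: "q (Suc n) = q n * ?K" by (simp add: q_Suc power2_eq_square algebra_simps)
  have P: "p (Suc n) = p n * ?K + 1" by (simp add: p_Suc algebra_simps)
  let ?a = "\<lfloor>real (q (Suc n)) * \<theta>\<rfloor>"
  have "\<lfloor>real (q n) * \<theta>\<rfloor> = \<lfloor>(real (q (Suc n)) * \<theta>) / of_int (int ?K)\<rfloor>"
    using K Q by (simp add: field_simps)
  also have "\<dots> = ?a div int ?K" by (rule floor_divide_real_eq_div) simp
  finally have fl: "\<lfloor>real (q n) * \<theta>\<rfloor> = ?a div int ?K" .
  have "[int (p (Suc n)) * int t = ?a] (mod int (q (Suc n)))"
    unfolding t_def by (rule level_cong) fact
  then obtain z where z: "int (p (Suc n)) * int t = ?a + int (q (Suc n)) * z"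
    by (metis cong_iff_lin cong_sym)
  have "?a = int t + (int (p n) * int t - int (q n) * z) * int ?K"
    using z unfolding P Q by (simp add: algebra_simps)
  hence "?a div int ?K = int t div int ?K + (int (p n) * int t - int (q n) * z)"
    using K by (simp add: div_mult_self1)
  hence fl': "\<lfloor>real (q n) * \<theta>\<rfloor> = int (p n) * int t + int ?i + int (q n) * (- z)"
    using fl by (simp add: zdiv_int)
  have c: "[int (p n) * int (inv_p n ?i) = int ?i] (mod int (q n))"
    using inv_p(2)[of n ?i] by (simp flip: cong_int_iff)
  have "[int (p n) * int (level n \<theta>) = \<lfloor>real (q n) * \<theta>\<rfloor>] (mod int (q n))" by (rule level_cong) fact
  also have "[\<lfloor>real (q n) * \<theta>\<rfloor> = int (p n) * int t + int ?i] (mod int (q n))"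
    unfolding fl' by (simp add: cong_iff_dvd_diff)
  also have "[int (p n) * int t + int ?i = int (p n) * int t + int (p n) * int (inv_p n ?i)] (mod int (q n))"
    by (rule cong_add[OF cong_refl cong_sym[OF c]])
  finally show "[int (p n) * int (level n \<theta>) = int (p n) * (int t + int (inv_p n ?i))] (mod int (q n))"
    by (simp add: distrib_left)
qed

section \<open>Names at finite stages and the limiting coding\<close>

definition cyclic_name :: "nat \<Rightarrow> real \<Rightarrow> int \<Rightarrow> sym" where
  "cyclic_name n \<theta> s = w n ! nat ((int (level n \<theta>) + s) mod int (q n))"

text \<open>After a move by at most \<open>q n\<close>, the margin \<open>2 * q n\<close> still
  leaves \<open>q n\<close> letters on both sides, enough to stay clear of the two spacers of the
  factor.\<close>

definition deep :: "nat \<Rightarrow> real \<Rightarrow> bool" where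
  "deep n \<theta> \<longleftrightarrow> (let u = level (Suc n) \<theta> mod (l n * q n) in 2 * q n \<le> u \<and> u + 2 * q n \<le> l n * q n)"

text \<open>The moved offset v still lies among the copies of \<open>w n\<close>, so the letter is
  the one of \<open>w n\<close> at v plus j_i. By \<open>level_Suc\<close> this is the position
  obtained by moving at stage n.\<close>

lemma deep_cyclic_name:
  assumes "0 \<le> \<theta>" "deep n \<theta>" "\<bar>s\<bar> \<le> int (q n)"
  shows "cyclic_name (Suc n) \<theta> s = cyclic_name n \<theta> s"
    and "0 \<le> int (level (Suc n) \<theta>) + s" "int (level (Suc n) \<theta>) + s < int (q (Suc n))"
proof -
  let ?lq = "l n * q n" and ?t = "level (Suc n) \<theta>"
  define u where "u = ?t mod ?lq"
  define v where "v = nat (int u + s)"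
  define i where "i = ?t div (k n * ?lq)"
  define t' where "t' = nat (int ?t + s)"
  have u: "2 * q n \<le> u" "u + 2 * q n \<le> ?lq" using assms(2) by (simp_all add: deep_def u_def Let_def)
  have v: "int v = int u + s" "q n \<le> v" "v + q n \<le> ?lq" using u assms(3) by (auto simp: v_def)
  have vlq: "v < ?lq" using v(3) q_pos[of n] by linarith
  have tu: "?t = ?t div ?lq * ?lq + u" unfolding u_def by (rule div_mult_mod_eq[symmetric])
  define D where "D = ?t div ?lq"
  have tD: "int ?t = int (D * ?lq) + int u" using tu unfolding D_def by (metis of_nat_add)
  have ts: "int ?t + s = int (D * ?lq + v)" using v(1) tD by simp
  have t'1: "t' = D * ?lq + v" unfolding t'_def ts by (rule nat_int)
  have t'2: "int t' = int ?t + s" unfolding t'1 ts by simp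
  note t' = t'1[unfolded D_def] t'2
  have tm: "t' mod ?lq = v" unfolding t'1 using vlq by simp
  have "t' div ?lq = D" unfolding t'1 using vlq lpos[of n] by (subst div_mult_self3) auto
  hence "t' div ?lq = ?t div ?lq" by (simp add: D_def)
  hence td: "t' div (k n * ?lq) = i" by (metis div_mult2_eq mult.commute i_def)
  have K: "k n * ?lq > 0" using k2[of n] lpos[of n] by simp
  have Q: "q (Suc n) = q n * (k n * ?lq)" by (simp add: q_Suc power2_eq_square algebra_simps)
  have "i < q n" using nth_w_Suc(1)[OF level_less] by (simp add: i_def)
  have "t' < (i + 1) * (k n * ?lq)" using td K
    by (metis dividend_less_div_times mult.commute Suc_eq_plus1 mult_Suc add.commute)
  also have "\<dots> \<le> q n * (k n * ?lq)" using \<open>i < q n\<close> by (intro mult_le_mono) auto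
  finally have t'Q: "t' < q (Suc n)" using Q by simp
  show "0 \<le> int ?t + s" "int ?t + s < int (q (Suc n))" using t'(2) t'Q by linarith+
  have j: "inv_p n i < q n" by (rule inv_p)
  have "w (Suc n) ! t' = w n ! ((v + inv_p n i) mod q n)"
  proof -
    have "\<not> v < q n - inv_p n i" "v < ?lq - inv_p n i" using v j by linarith+
    thus ?thesis using nth_w_Suc(2)[OF t'Q] unfolding tm td by simp
  qed
  moreover have "cyclic_name (Suc n) \<theta> s = w (Suc n) ! t'"
    using t'Q t'(2) by (simp add: cyclic_name_def flip: t'(2))
  moreover have "(int (level n \<theta>) + s) mod int (q n) = int ((v + inv_p n i) mod q n)"
  proof -
    have "[int (level n \<theta>) + s = int ?t + int (inv_p n i) + s] (mod int (q n))"
      unfolding i_def by (intro cong_add level_Suc assms cong_refl)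
    also have "int ?t + int (inv_p n i) + s = int (v + inv_p n i) + int (q n) * int (?t div ?lq * l n)"
      using tD v(1) by (simp add: D_def[symmetric] algebra_simps)
    finally show ?thesis by (simp add: cong_def zmod_int)
  qed
  ultimately show "cyclic_name (Suc n) \<theta> s = cyclic_name n \<theta> s" by (simp add: cyclic_name_def)
qed

text \<open>Under this condition, rotation by \<open>\<alpha>\<close> and by \<open>\<alpha>\<^sub>n\<close> move \<open>\<theta>\<close> into the same interval of length \<open>1/q\<^sub>n\<close>.\<close>

definition no_carry :: "nat \<Rightarrow> real \<Rightarrow> bool" where
  "no_carry n \<theta> \<longleftrightarrow> frac (real (q n) * \<theta>) + real (q n) * (alpha - al n) < 1"

text \<open>Since \<open>q n * alpha\<close> is \<open>p n\<close> plus the small term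
  \<open>q n * (alpha - al n)\<close>, without a carry the integer part grows by exactly
  \<open>p n\<close> modulo \<open>q n\<close>, which is one step in position.\<close>

lemma level_rot:
  assumes "0 \<le> \<theta>" "no_carry n \<theta>"
  shows "[int (level n (rot alpha \<theta>)) = int (level n \<theta>) + 1] (mod int (q n))"
proof (rule p_cancel)
  let ?m = "\<lfloor>\<theta> + alpha\<rfloor>"
  have "real (q n) * rot alpha \<theta> = of_int (\<lfloor>real (q n) * \<theta>\<rfloor> + int (p n) - int (q n) * ?m) + (frac (real (q n) * \<theta>) + real (q n) * (alpha - al n))"
    by (simp add: rot_def frac_def circ_alpha_def algebra_simps)
  moreover have "0 \<le> frac (real (q n) * \<theta>) + real (q n) * (alpha - al n)" using alpha_diff_pos[of n] by (intro add_nonneg_nonneg mult_nonneg_nonneg) auto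
  ultimately have fl: "\<lfloor>real (q n) * rot alpha \<theta>\<rfloor> = \<lfloor>real (q n) * \<theta>\<rfloor> + int (p n) - int (q n) * ?m"
    using assms(2) unfolding no_carry_def by (intro floor_unique) linarith+
  have "[int (p n) * int (level n (rot alpha \<theta>)) = \<lfloor>real (q n) * rot alpha \<theta>\<rfloor>] (mod int (q n))"
    by (rule level_cong) (simp add: rot_def)
  also have "[\<lfloor>real (q n) * rot alpha \<theta>\<rfloor> = \<lfloor>real (q n) * \<theta>\<rfloor> + int (p n)] (mod int (q n))"
    unfolding fl by (simp add: cong_iff_dvd_diff)
  also have "[\<lfloor>real (q n) * \<theta>\<rfloor> + int (p n) = int (p n) * int (level n \<theta>) + int (p n)] (mod int (q n))"
    by (intro cong_add cong_refl cong_sym[OF level_cong] assms)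
  finally show "[int (p n) * int (level n (rot alpha \<theta>)) = int (p n) * (int (level n \<theta>) + 1)] (mod int (q n))"
    by (simp add: distrib_left)
qed

lemma cyclic_name_rot:
  assumes "0 \<le> \<theta>" "no_carry n \<theta>"
  shows "cyclic_name n (rot alpha \<theta>) s = cyclic_name n \<theta> (s + 1)"
proof -
  have "[int (level n (rot alpha \<theta>)) + s = int (level n \<theta>) + 1 + s] (mod int (q n))"
    by (intro cong_add level_rot assms cong_refl)
  thus ?thesis by (simp add: cyclic_name_def cong_def add.assoc add.commute[of 1])
qed

text \<open>The eventual letter of the names at finite stages; \<open>Esym\<close> doubles as the
  default when no letter is eventually constant.\<close>

definition coding :: "real \<Rightarrow> int \<Rightarrow> sym" where
  "coding \<theta> s = (if eventually (\<lambda>n. cyclic_name n \<theta> s = Star) sequentially then Star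
     else if eventually (\<lambda>n. cyclic_name n \<theta> s = Bsym) sequentially then Bsym else Esym)"

definition Y0 :: "real set" where
  "Y0 = {\<theta>\<in>{0..<1}. eventually (\<lambda>n. deep n \<theta>) sequentially \<and> eventually (\<lambda>n. no_carry n \<theta>) sequentially}"

text \<open>As \<open>q\<close> is increasing, s stays in the range of
  \<open>deep_cyclic_name\<close> at all later stages, and the name no longer changes.\<close>

lemma coding_eq_cyclic_name:
  assumes "0 \<le> \<theta>" "\<And>m. m \<ge> n \<Longrightarrow> deep m \<theta>" "\<bar>s\<bar> \<le> int (q n)" "m \<ge> n"
  shows "coding \<theta> s = cyclic_name m \<theta> s"
proof -
  have *: "cyclic_name m \<theta> s = cyclic_name n \<theta> s" if "m \<ge> n" for m
    using that
  proof (induction m rule: dec_induct)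
    case (step m)
    have "\<bar>s\<bar> \<le> int (q m)" using assms(3) q_mono[OF step(1)] by linarith
    thus ?case using deep_cyclic_name(1)[OF assms(1) assms(2)[OF step(1)]] step by simp
  qed simp
  have ev: "eventually (\<lambda>m. cyclic_name m \<theta> s = cyclic_name n \<theta> s) sequentially"
    using * eventually_sequentially by blast
  have "eventually (\<lambda>m. cyclic_name m \<theta> s = y) sequentially \<longleftrightarrow> y = cyclic_name n \<theta> s" for y
  proof
    assume "eventually (\<lambda>m. cyclic_name m \<theta> s = y) sequentially"
    from eventually_happens'[OF sequentially_bot eventually_conj[OF this ev]] show "y = cyclic_name n \<theta> s" by auto
  qed (use ev in simp)
  hence "coding \<theta> s = cyclic_name n \<theta> s" unfolding coding_def by (cases "cyclic_name n \<theta> s") auto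
  thus ?thesis using *[OF assms(4)] by simp
qed

lemma coding_rot:
  assumes "\<theta> \<in> Y0"
  shows "coding (rot alpha \<theta>) = sh (coding \<theta>)"
proof
  fix s
  have "eventually (\<lambda>n. cyclic_name n (rot alpha \<theta>) s = cyclic_name n \<theta> (s + 1)) sequentially"
    using assms cyclic_name_rot by (auto simp: Y0_def elim: eventually_mono)
  hence "eventually (\<lambda>n. cyclic_name n (rot alpha \<theta>) s = y) sequentially \<longleftrightarrow>
        eventually (\<lambda>n. cyclic_name n \<theta> (s + 1) = y) sequentially" for y
    by (intro eventually_cong) (auto elim: eventually_mono)
  thus "coding (rot alpha \<theta>) s = sh (coding \<theta>) s" by (simp add: coding_def sh_def)
qed

lemma coding_in_K:
  assumes "\<theta> \<in> Y0"
  shows "coding \<theta> \<in> circle_factor k l"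
  unfolding circle_factor_def
proof (intro CollectI allI impI)
  fix a b :: int assume ab: "a \<le> b"
  obtain n0 where n0: "\<And>m. m \<ge> n0 \<Longrightarrow> deep m \<theta>" using assms by (auto simp: Y0_def eventually_sequentially)
  have th: "0 \<le> \<theta>" using assms by (auto simp: Y0_def)
  \<comment> \<open>At this stage \<open>q n\<close> bounds both ends of the window, so the window
    sits inside \<open>w (Suc n)\<close> without wrapping around.\<close>
  define n where "n = max n0 (nat \<bar>a\<bar> + nat \<bar>b\<bar>)"
  have n: "\<And>m. m \<ge> n \<Longrightarrow> deep m \<theta>" using n0 by (auto simp: n_def)
  have qn: "int (q n) \<ge> \<bar>a\<bar>" "int (q n) \<ge> \<bar>b\<bar>" using q_ge[of n] n_def by linarith+
  have s: "\<bar>s\<bar> \<le> int (q n)" if "s \<in> {a..b}" for s using that qn by auto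
  let ?t = "int (level (Suc n) \<theta>)" and ?W = "w (Suc n)"
  have val: "coding \<theta> s = ?W ! nat (?t + s)" "0 \<le> ?t + s" "?t + s < int (q (Suc n))" if "s \<in> {a..b}" for s
  proof -
    show 1: "0 \<le> ?t + s" "?t + s < int (q (Suc n))" using deep_cyclic_name(2,3)[OF th n s[OF that]] by auto
    show "coding \<theta> s = ?W ! nat (?t + s)"
      using coding_eq_cyclic_name[OF th n s[OF that], of "Suc n"] 1 by (simp add: cyclic_name_def)
  qed
  have "map (coding \<theta>) [a..b] = take (length [a..b]) (drop (nat (?t + a)) ?W)"
  proof (rule nth_equalityI)
    have "nat (b - a + 1) + nat (?t + a) \<le> q (Suc n)" using val(3)[of b] val(2)[of a] ab by simp
    thus len: "length (map (coding \<theta>) [a..b]) = length (take (length [a..b]) (drop (nat (?t + a)) ?W))"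
      by (simp add: length_w)
    fix i assume i: "i < length (map (coding \<theta>) [a..b])"
    hence ai: "a + int i \<in> {a..b}" by auto
    have "map (coding \<theta>) [a..b] ! i = coding \<theta> (a + int i)" using i by (simp add: nth_upto)
    also have "\<dots> = ?W ! nat (?t + (a + int i))" by (rule val(1)[OF ai])
    also have "nat (?t + (a + int i)) = nat (?t + a) + i" using val(2)[of a] ab by (simp add: nat_add_distrib)
    also have "?W ! (nat (?t + a) + i) = take (length [a..b]) (drop (nat (?t + a)) ?W) ! i"
      using i val(2,3)[OF ai] ab val(2)[of a] by (simp add: length_w)
    finally show "map (coding \<theta>) [a..b] ! i = take (length [a..b]) (drop (nat (?t + a)) ?W) ! i" .
  qed
  moreover have "sublist (take (length [a..b]) (drop (nat (?t + a)) ?W)) ?W"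
    by (rule sublist_order.order_trans[OF sublist_take sublist_drop])
  ultimately show "\<exists>n. sublist (map (coding \<theta>) [a..b]) (w n)" by metis
qed

lemma eventually_l_ge2: "eventually (\<lambda>n. l n \<ge> 2) sequentially"
proof -
  have "(\<lambda>n. 1 / real (l n)) \<longlonglongrightarrow> 0" using lsum by (rule summable_LIMSEQ_zero)
  hence "eventually (\<lambda>n. 1 / real (l n) < 1) sequentially" by (rule order_tendstoD) simp
  thus ?thesis
  proof eventually_elim
    case (elim n)
    hence "l n \<noteq> 1" by auto
    thus ?case using lpos[of n] by linarith
  qed
qed

section \<open>Recovering the point from its coding\<close>

definition matches :: "nat \<Rightarrow> (int \<Rightarrow> sym) \<Rightarrow> nat \<Rightarrow> bool" where
  "matches n x t \<longleftrightarrow> (\<forall>s<q n. x (int s) = w n ! ((t + s) mod q n))"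

text \<open>The value \<open>q n\<close> signals that no position matches.\<close>

definition decode :: "nat \<Rightarrow> (int \<Rightarrow> sym) \<Rightarrow> nat" where
  "decode n x = (LEAST t. t = q n \<or> (t < q n \<and> matches n x t))"

text \<open>The quotient is the left end point of the interval of length 1 / \<open>q n\<close>
  attached to the decoded position.\<close>

definition decoding :: "(int \<Rightarrow> sym) \<Rightarrow> real" where
  "decoding x = lim (\<lambda>n. real (p n * decode n x mod q n) / real (q n))"

text \<open>The coding agrees with the cyclic name on the first \<open>q n\<close> places, so the
  true position matches, and by \<open>w_rotation_inj\<close> no other one does.\<close>

lemma decode_coding:
  assumes "\<theta> \<in> Y0"
  shows "eventually (\<lambda>n. decode n (coding \<theta>) = level n \<theta>) sequentially"
proof -
  obtain n0 where n0: "\<And>m. m \<ge> n0 \<Longrightarrow> deep m \<theta>" using assms by (auto simp: Y0_def eventually_sequentially)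
  obtain n1 where n1: "\<And>m. m \<ge> n1 \<Longrightarrow> l m \<ge> 2" using eventually_l_ge2 by (auto simp: eventually_sequentially)
  have th: "0 \<le> \<theta>" using assms by (auto simp: Y0_def)
  \<comment> \<open>The summand 3 lets \<open>w_rotation_inj\<close> be used at the predecessor m of
    n, which is then at least 2 and at least \<open>n1\<close>.\<close>
  have "decode n (coding \<theta>) = level n \<theta>" if "n \<ge> n0 + n1 + 3" for n
  proof -
    define m where "m = n - 1"
    have m: "n = Suc m" "m \<ge> 2" "l m \<ge> 2" using that n1[of m] by (auto simp: m_def)
    have val: "coding \<theta> (int s) = w n ! ((level n \<theta> + s) mod q n)" if "s < q n" for s
    proof -
      have "coding \<theta> (int s) = cyclic_name n \<theta> (int s)"
        using that \<open>n \<ge> n0 + n1 + 3\<close> by (intro coding_eq_cyclic_name[OF th, of n]) (auto intro: n0)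
      also have "\<dots> = w n ! ((level n \<theta> + s) mod q n)"
        by (simp add: cyclic_name_def nat_mod_as_int flip: of_nat_add)
      finally show ?thesis .
    qed
    have un: "t = level n \<theta>" if "t < q n" "matches n (coding \<theta>) t" for t
      by (rule w_rotation_inj[OF m(2,3)], unfold m(1)[symmetric])
         (use that val in \<open>auto simp: matches_def\<close>)
    show ?thesis unfolding decode_def
    proof (rule Least_equality)
      show "level n \<theta> = q n \<or> level n \<theta> < q n \<and> matches n (coding \<theta>) (level n \<theta>)"
        using val by (auto simp: matches_def)
      show "level n \<theta> \<le> t" if "t = q n \<or> t < q n \<and> matches n (coding \<theta>) t" for t
        using that un[of t] level_less[of n \<theta>] by (auto intro: less_imp_le)
    qed
  qed
  thus ?thesis unfolding eventually_sequentially by blast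
qed

text \<open>The decoded position is eventually the true one, whose left end point is within 1 /
  \<open>q n\<close> of \<theta>.\<close>

lemma decoding_coding:
  assumes "\<theta> \<in> Y0"
  shows "decoding (coding \<theta>) = \<theta>"
proof -
  have th: "0 \<le> \<theta>" "\<theta> < 1" using assms by (auto simp: Y0_def)
  have eq: "real (p n * level n \<theta> mod q n) = of_int \<lfloor>real (q n) * \<theta>\<rfloor>" for n
  proof -
    have "0 \<le> \<lfloor>real (q n) * \<theta>\<rfloor>" "\<lfloor>real (q n) * \<theta>\<rfloor> < int (q n)" using th by (auto simp: floor_less_iff)
    hence "int (p n * level n \<theta> mod q n) = \<lfloor>real (q n) * \<theta>\<rfloor>"
      using level_cong[OF th(1), of n] by (simp add: cong_def zmod_int)
    thus ?thesis by (metis of_int_of_nat_eq)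
  qed
  have iq: "(\<lambda>n. 1 / real (q n)) \<longlonglongrightarrow> 0"
  proof (rule tendsto_sandwich[OF _ _ tendsto_const LIMSEQ_inverse_real_of_nat])
    have "1 / real (q n) \<le> inverse (real (Suc n))" for n
    proof -
      have "n < 2 ^ n" by (rule less_exp)
      hence "Suc n \<le> q n" using q_ge_pow[of n] by linarith
      hence "real (Suc n) \<le> real (q n)" using of_nat_le_iff by blast
      thus ?thesis by (simp add: field_simps)
    qed
    thus "eventually (\<lambda>n. 1 / real (q n) \<le> inverse (real (Suc n))) sequentially" by simp
  qed simp
  have "(\<lambda>n. of_int \<lfloor>real (q n) * \<theta>\<rfloor> / real (q n)) \<longlonglongrightarrow> \<theta>"
  proof (rule LIM_zero_cancel, rule Lim_null_comparison[OF _ iq])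
    have "\<bar>of_int \<lfloor>real (q n) * \<theta>\<rfloor> / real (q n) - \<theta>\<bar> \<le> 1 / real (q n)" for n
    proof -
      have "of_int \<lfloor>real (q n) * \<theta>\<rfloor> / real (q n) - \<theta> = (of_int \<lfloor>real (q n) * \<theta>\<rfloor> - real (q n) * \<theta>) / real (q n)"
        by (simp add: field_simps)
      moreover have "\<bar>of_int \<lfloor>real (q n) * \<theta>\<rfloor> - real (q n) * \<theta>\<bar> \<le> 1" by linarith
      ultimately show ?thesis by (simp add: abs_divide divide_right_mono)
    qed
    thus "eventually (\<lambda>n. norm (of_int \<lfloor>real (q n) * \<theta>\<rfloor> / real (q n) - \<theta>) \<le> 1 / real (q n)) sequentially" by simp
  qed
  hence "(\<lambda>n. real (p n * decode n (coding \<theta>) mod q n) / real (q n)) \<longlonglongrightarrow> \<theta>"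
    by (rule Lim_transform_eventually) (use decode_coding[OF assms] eq in \<open>auto elim!: eventually_mono\<close>)
  thus ?thesis unfolding decoding_def by (rule limI)
qed

end

subsection \<open>Almost every point of the circle has a coding\<close>

instance sym :: finite
proof
  have "(UNIV :: sym set) = {Star, Bsym, Esym}" by (auto intro: sym.exhaust)
  thus "finite (UNIV :: sym set)" by (metis finite.emptyI finite_insert)
qed

text \<open>Needed to test Borel measurability of sequence-valued maps one coordinate at a
  time.\<close>

instance sym :: second_countable_topology
proof
  have "(open :: sym set \<Rightarrow> bool) = generate_topology UNIV"
    by (rule ext) (auto simp: open_sym_def intro: generate_topology.Basis)
  moreover have "countable (UNIV :: sym set set)" by (simp add: uncountable_infinite)
  ultimately show "\<exists>B :: sym set set. countable B \<and> open = generate_topology B" by blast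
qed

lemma sets_borel_sym: "sets (borel :: sym measure) = UNIV"
  by (auto simp: open_sym_def intro: borel_open)

lemma measurable_borel_sym: "measurable M (borel :: sym measure) = measurable M (count_space UNIV)"
  by (rule measurable_cong_sets) (simp_all add: sets_borel_sym)

lemma measurable_coord [measurable]: "(\<lambda>x :: int \<Rightarrow> sym. x s) \<in> measurable borel (count_space UNIV)"
  unfolding measurable_borel_sym[symmetric] by (intro borel_measurable_continuous_onI) simp

lemma borel_measurable_seqI:
  assumes "\<And>s. (\<lambda>x. f x s) \<in> measurable M (count_space UNIV)"
  shows "(f :: 'a \<Rightarrow> int \<Rightarrow> sym) \<in> measurable M borel"
  by (rule measurable_coordinatewise_then_product) (simp add: measurable_borel_sym assms)

lemma sh_measurable: "sh \<in> measurable borel borel"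
  unfolding sh_def by (rule borel_measurable_seqI) measurable

lemma sh_circle_factor: "x \<in> circle_factor k l \<Longrightarrow> sh x \<in> circle_factor k l"
  unfolding circle_factor_def
proof (intro CollectI allI impI)
  fix a b :: int assume x: "x \<in> {x. \<forall>a b. a \<le> b \<longrightarrow> (\<exists>n. sublist (map x [a..b]) (circ_w k l n))}" and "a \<le> b"
  have "map (sh x) [a..b] = map x [a+1..b+1]"
    by (rule nth_equalityI) (auto simp: sh_def nth_upto algebra_simps)
  thus "\<exists>n. sublist (map (sh x) [a..b]) (circ_w k l n)" using x \<open>a \<le> b\<close> by simp
qed

section \<open>Lebesgue measure and rotations of the circle\<close>

lemma space_circle_lebesgue [simp]: "space circle_lebesgue = {0..<1}"
  by (simp add: circle_lebesgue_def)

lemma sets_circle_lebesgue: "A \<in> sets circle_lebesgue \<longleftrightarrow> A \<subseteq> {0..<1} \<and> A \<in> sets borel"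
  by (simp add: circle_lebesgue_def sets_restrict_space_iff)

lemma emeasure_circle_lebesgue: "A \<subseteq> {0..<1} \<Longrightarrow> emeasure circle_lebesgue A = emeasure lborel A"
  by (simp add: circle_lebesgue_def emeasure_restrict_space)

lemma measurable_circle_lebesgueI: "f \<in> measurable borel N \<Longrightarrow> f \<in> measurable circle_lebesgue N"
  unfolding circle_lebesgue_def by (intro measurable_restrict_space1) simp

lemma prob_space_circle_lebesgue: "prob_space circle_lebesgue"
  by (rule prob_spaceI) (simp add: emeasure_circle_lebesgue)

lemma frac_measurable [measurable]: "frac \<in> borel_measurable (borel :: real measure)"
  unfolding frac_def[abs_def] by measurable

lemma rot_measurable [measurable]: "rot a \<in> borel_measurable borel"
  unfolding rot_def[abs_def] by measurable

lemma rot_measurable_circle: "rot a \<in> measurable circle_lebesgue circle_lebesgue"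
  unfolding circle_lebesgue_def
  by (intro measurable_restrict_space3) (auto simp: rot_def frac_lt_1)

lemma emeasure_lborel_translate:
  fixes B :: "real set"
  assumes "B \<in> sets borel"
  shows "emeasure lborel ((+) c -` B) = emeasure lborel B"
proof -
  have "emeasure lborel B = emeasure (distr lborel borel ((+) c)) B" by (simp add: lborel_distr_plus)
  also have "\<dots> = emeasure lborel ((+) c -` B)" using assms by (subst emeasure_distr) auto
  finally show ?thesis by simp
qed

text \<open>On [0, 1 - c) and on [1 - c, 1), with c the fractional part of a, the rotation is a
  translation, and the images [c, 1) and [0, c) partition the circle.\<close>

lemma distr_rot: "distr circle_lebesgue circle_lebesgue (rot a) = circle_lebesgue"
proof (rule measure_eqI)
  fix A assume "A \<in> sets (distr circle_lebesgue circle_lebesgue (rot a))"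
  hence A: "A \<in> sets circle_lebesgue" by simp
  hence A': "A \<subseteq> {0..<1}" "A \<in> sets borel" by (auto simp: sets_circle_lebesgue)
  define c where "c = frac a"
  have c: "0 \<le> c" "c < 1" by (auto simp: c_def frac_lt_1)
  have rot: "rot a x = (if x < 1 - c then c + x else (c - 1) + x)" if "x \<in> {0..<1}" for x
  proof -
    have "rot a x = frac (x + c)" unfolding rot_def c_def frac_def
      by (smt (verit) floor_diff_of_int of_int_diff)
    also have "\<dots> = (if x < 1 - c then c + x else (c - 1) + x)"
      using that c by (auto simp: frac_unique_iff)
    finally show ?thesis .
  qed
  have eq: "rot a -` A \<inter> {0..<1} = ((+) c -` (A \<inter> {c..<1})) \<union> ((+) (c - 1) -` (A \<inter> {0..<c}))"
    (is "_ = ?A1 \<union> ?A2")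
  proof (intro set_eqI iffI)
    fix x assume "x \<in> rot a -` A \<inter> {0..<1}"
    thus "x \<in> ?A1 \<union> ?A2" using rot[of x] c by (auto split: if_splits)
  next
    fix x assume x: "x \<in> ?A1 \<union> ?A2"
    hence "x \<in> {0..<1}" using c by auto
    thus "x \<in> rot a -` A \<inter> {0..<1}" using x rot[of x] c by (auto split: if_splits)
  qed
  have "emeasure (distr circle_lebesgue circle_lebesgue (rot a)) A = emeasure circle_lebesgue (rot a -` A \<inter> {0..<1})"
    using rot_measurable_circle A by (simp add: emeasure_distr)
  also have "\<dots> = emeasure lborel (rot a -` A \<inter> {0..<1})" by (rule emeasure_circle_lebesgue) auto
  also have "\<dots> = emeasure lborel (?A1 \<union> ?A2)" unfolding eq ..
  also have "\<dots> = emeasure lborel ?A1 + emeasure lborel ?A2"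
    by (rule plus_emeasure[symmetric]) (use A' in \<open>auto intro!: measurable_sets_borel[of _ borel]\<close>)
  also have "\<dots> = emeasure lborel (A \<inter> {c..<1}) + emeasure lborel (A \<inter> {0..<c})"
    using A' by (intro arg_cong2[where f="(+)"] emeasure_lborel_translate) auto
  also have "\<dots> = emeasure lborel ((A \<inter> {c..<1}) \<union> (A \<inter> {0..<c}))"
    using A' by (intro plus_emeasure) auto
  also have "(A \<inter> {c..<1}) \<union> (A \<inter> {0..<c}) = A" using A' c by auto
  also have "emeasure lborel A = emeasure circle_lebesgue A" using A' by (simp add: emeasure_circle_lebesgue)
  finally show "emeasure (distr circle_lebesgue circle_lebesgue (rot a)) A = emeasure circle_lebesgue A" .
qed simp

lemma AE_rot_iterate:
  assumes "AE \<theta> in circle_lebesgue. P \<theta>"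
  shows "AE \<theta> in circle_lebesgue. P ((rot a ^^ s) \<theta>)"
proof (induction s)
  case (Suc s)
  hence "AE \<theta> in distr circle_lebesgue circle_lebesgue (rot a). P ((rot a ^^ s) \<theta>)"
    by (subst distr_rot)
  from AE_distrD[OF rot_measurable_circle this] show ?case by (simp add: funpow_Suc_right del: funpow.simps)
qed (use assms in simp)

context circ_seq begin

section \<open>Measurability and Borel-Cantelli estimates\<close>

lemma level_measurable [measurable]: "level n \<in> measurable borel (count_space UNIV)"
  unfolding level_def[abs_def] by measurable

lemma deep_measurable [measurable]: "Measurable.pred borel (deep n)"
  unfolding deep_def[abs_def] Let_def by measurable

lemma no_carry_measurable [measurable]: "Measurable.pred borel (no_carry n)"
  unfolding no_carry_def[abs_def] by measurable

lemma cyclic_name_measurable [measurable]: "(\<lambda>\<theta>. cyclic_name n \<theta> s) \<in> measurable borel (count_space UNIV)"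
  unfolding cyclic_name_def by measurable

lemma coding_measurable [measurable]: "coding \<in> measurable borel borel"
  by (rule borel_measurable_seqI) (unfold coding_def eventually_sequentially, measurable)

lemma Y0_sets [measurable]: "Y0 \<in> sets borel"
  unfolding Y0_def eventually_sequentially by measurable

lemma decode_measurable [measurable]: "decode n \<in> measurable borel (count_space UNIV)"
  unfolding decode_def[abs_def] matches_def by measurable

lemma decoding_measurable [measurable]: "decoding \<in> measurable borel borel"
  unfolding decoding_def[abs_def] by measurable

text \<open>The position t determines the integer part of \<open>q n * \<theta>\<close> as
  \<open>p n * t mod q n\<close>, so each position accounts for one interval of length 1 /
  \<open>q n\<close>.\<close>

lemma measure_level_le:
  assumes "finite S"
  shows "emeasure lborel {\<theta>\<in>{0..<1}. level n \<theta> \<in> S} \<le> ennreal (real (card S) / real (q n))"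
proof -
  let ?I = "\<lambda>t. {real (p n * t mod q n) / real (q n) ..< real (p n * t mod q n + 1) / real (q n)}"
  have "{\<theta>\<in>{0..<1}. level n \<theta> \<in> S} \<subseteq> (\<Union>t\<in>S. ?I t)"
  proof
    fix \<theta> assume th: "\<theta> \<in> {\<theta>\<in>{0..<1}. level n \<theta> \<in> S}"
    have "0 \<le> \<lfloor>real (q n) * \<theta>\<rfloor>" "\<lfloor>real (q n) * \<theta>\<rfloor> < int (q n)" using th by (auto simp: floor_less_iff)
    hence "int (p n * level n \<theta> mod q n) = \<lfloor>real (q n) * \<theta>\<rfloor>"
      using level_cong[of \<theta> n] th by (simp add: cong_def zmod_int)
    hence "real (p n * level n \<theta> mod q n) = of_int \<lfloor>real (q n) * \<theta>\<rfloor>" by (metis of_int_of_nat_eq)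
    hence "real (p n * level n \<theta> mod q n) \<le> real (q n) * \<theta>" "real (q n) * \<theta> < real (p n * level n \<theta> mod q n) + 1"
      by linarith+
    hence "\<theta> \<in> ?I (level n \<theta>)" by (auto simp: divide_le_eq less_divide_eq mult.commute add.commute)
    thus "\<theta> \<in> (\<Union>t\<in>S. ?I t)" using th by auto
  qed
  hence "emeasure lborel {\<theta>\<in>{0..<1}. level n \<theta> \<in> S} \<le> emeasure lborel (\<Union>t\<in>S. ?I t)"
    using assms by (intro emeasure_mono) auto
  also have "\<dots> \<le> (\<Sum>t\<in>S. emeasure lborel (?I t))"
    using assms by (intro emeasure_subadditive_finite) auto
  also have "\<dots> = (\<Sum>t\<in>S. ennreal (1 / real (q n)))"
    by (intro sum.cong refl) (simp add: divide_right_mono diff_divide_distrib[symmetric])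
  also have "\<dots> = ennreal (real (card S) / real (q n))"
    by (simp add: ennreal_of_nat_eq_real_of_nat ennreal_mult[symmetric])
  finally show ?thesis .
qed

text \<open>A position is determined by its quotient and remainder modulo \<open>l n * q n\<close>.
  There are \<open>k n * q n\<close> quotients, and the bad remainders lie within
  \<open>2 * q n\<close> of an end of the factor.\<close>

lemma card_bad_le:
  "card {t\<in>{..<q (Suc n)}. \<not> (2 * q n \<le> t mod (l n * q n) \<and> t mod (l n * q n) + 2 * q n \<le> l n * q n)}
     \<le> k n * q n * (4 * q n)" (is "card ?S \<le> _")
proof -
  let ?lq = "l n * q n"
  let ?U = "{..<2 * q n} \<union> {?lq - 2 * q n..<?lq}"
  let ?f = "\<lambda>t. (t div ?lq, t mod ?lq)"
  have lq: "?lq > 0" using lpos[of n] by simp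
  have Q: "q (Suc n) = k n * q n * ?lq" by (simp add: q_Suc power2_eq_square algebra_simps)
  have "inj_on ?f ?S" by (rule inj_onI) (metis Pair_inject div_mult_mod_eq)
  moreover have "?f ` ?S \<subseteq> {..<k n * q n} \<times> ?U"
    using lq Q by (auto simp: less_mult_imp_div_less)
  ultimately have "card ?S \<le> card ({..<k n * q n} \<times> ?U)" by (intro card_inj_on_le) auto
  also have "\<dots> = k n * q n * card ?U" by (simp add: card_cartesian_product)
  also have "card ?U \<le> card {..<2 * q n} + card {?lq - 2 * q n..<?lq}" by (rule card_Un_le)
  hence "card ?U \<le> 4 * q n" by simp
  hence "k n * q n * card ?U \<le> k n * q n * (4 * q n)" by (intro mult_le_mono) auto
  finally show ?thesis .
qed

text \<open>The bad positions at stage n make up at most the fraction 4 / \<open>l n\<close>, and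
  these bounds are summable.\<close>

lemma AE_deep: "AE \<theta> in circle_lebesgue. eventually (\<lambda>n. deep n \<theta>) sequentially"
proof -
  interpret prob_space circle_lebesgue by (rule prob_space_circle_lebesgue)
  let ?A = "\<lambda>n. {\<theta>\<in>{0..<1}. \<not> deep n \<theta>}"
  have A: "?A n \<in> sets circle_lebesgue" for n unfolding sets_circle_lebesgue by (auto simp: deep_measurable)
  have bound: "measure circle_lebesgue (?A n) \<le> 4 * (1 / real (l n))" for n
  proof -
    let ?S = "{t\<in>{..<q (Suc n)}. \<not> (2 * q n \<le> t mod (l n * q n) \<and> t mod (l n * q n) + 2 * q n \<le> l n * q n)}"
    have A_eq: "?A n = {\<theta>\<in>{0..<1}. level (Suc n) \<theta> \<in> ?S}" by (auto simp: deep_def Let_def)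
    have "emeasure circle_lebesgue (?A n) = emeasure lborel (?A n)" by (rule emeasure_circle_lebesgue) auto
    also have "\<dots> \<le> ennreal (real (card ?S) / real (q (Suc n)))"
      unfolding A_eq by (rule measure_level_le) simp
    also have "\<dots> \<le> ennreal (real (k n * q n * (4 * q n)) / real (q (Suc n)))"
      by (intro ennreal_leI divide_right_mono of_nat_mono card_bad_le) auto
    also have "real (k n * q n * (4 * q n)) / real (q (Suc n)) = 4 * (1 / real (l n))"
      using k2[of n] lpos[of n] by (simp add: q_Suc power2_eq_square field_simps)
    finally show ?thesis by (simp add: emeasure_eq_measure)
  qed
  have "summable (\<lambda>n. measure circle_lebesgue (?A n))"
  proof (rule summable_comparison_test')
    show "summable (\<lambda>n. 4 * (1 / real (l n)))" using lsum by (rule summable_mult)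
  qed (use bound in auto)
  from borel_cantelli_AE1[OF A _ this]
  have "AE \<theta> in circle_lebesgue. eventually (\<lambda>n. \<theta> \<in> space circle_lebesgue - ?A n) sequentially"
    by (simp add: emeasure_eq_measure)
  thus ?thesis by (rule AE_mp) (auto intro!: AE_I2 elim: eventually_mono)
qed

text \<open>A carry occurs only in the last part, of length \<open>alpha - al n\<close>, of each of
  the \<open>q n\<close> intervals. The total length is at most 1 / \<open>q n\<close>, which is
  summable.\<close>

lemma AE_no_carry: "AE \<theta> in circle_lebesgue. eventually (\<lambda>n. no_carry n \<theta>) sequentially"
proof -
  interpret prob_space circle_lebesgue by (rule prob_space_circle_lebesgue)
  let ?A = "\<lambda>n. {\<theta>\<in>{0..<1}. \<not> no_carry n \<theta>}"
  have A: "?A n \<in> sets circle_lebesgue" for n unfolding sets_circle_lebesgue by (auto simp: no_carry_measurable)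
  have bound: "measure circle_lebesgue (?A n) \<le> (1 / 2) ^ n" for n
  proof -
    let ?d = "real (q n) * (alpha - al n)"
    let ?I = "\<lambda>a. {(real a + (1 - ?d)) / real (q n) ..< (real a + 1) / real (q n)}"
    have d: "0 \<le> ?d" using alpha_diff_pos[of n] by (intro mult_nonneg_nonneg) auto
    have "?A n \<subseteq> (\<Union>a\<in>{..<q n}. ?I a)"
    proof
      fix \<theta> assume th: "\<theta> \<in> ?A n"
      let ?a = "nat \<lfloor>real (q n) * \<theta>\<rfloor>"
      have f: "0 \<le> \<lfloor>real (q n) * \<theta>\<rfloor>" "\<lfloor>real (q n) * \<theta>\<rfloor> < int (q n)" using th by (auto simp: floor_less_iff)
      hence a: "real ?a = of_int \<lfloor>real (q n) * \<theta>\<rfloor>" "?a < q n" by (auto simp: nat_less_iff)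
      have "real ?a + (1 - ?d) \<le> real (q n) * \<theta>" using th unfolding a by (auto simp: no_carry_def frac_def)
      moreover have "real (q n) * \<theta> < real ?a + 1" unfolding a by linarith
      ultimately have "\<theta> \<in> ?I ?a" by (auto simp: divide_le_eq less_divide_eq mult.commute)
      thus "\<theta> \<in> (\<Union>a\<in>{..<q n}. ?I a)" using a(2) by blast
    qed
    hence "emeasure lborel (?A n) \<le> emeasure lborel (\<Union>a\<in>{..<q n}. ?I a)"
      by (rule emeasure_mono) simp
    moreover have "emeasure circle_lebesgue (?A n) = emeasure lborel (?A n)" by (rule emeasure_circle_lebesgue) auto
    ultimately have "emeasure circle_lebesgue (?A n) \<le> emeasure lborel (\<Union>a\<in>{..<q n}. ?I a)" by simp
    also have "\<dots> \<le> (\<Sum>a\<in>{..<q n}. emeasure lborel (?I a))"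
      by (intro emeasure_subadditive_finite) auto
    also have "\<dots> = (\<Sum>a\<in>{..<q n}. ennreal (?d / real (q n)))"
    proof (intro sum.cong refl)
      fix a
      have "(real a + (1 - ?d)) / real (q n) \<le> (real a + 1) / real (q n)" using d by (intro divide_right_mono) auto
      hence "emeasure lborel (?I a) = ennreal ((real a + 1) / real (q n) - (real a + (1 - ?d)) / real (q n))"
        by simp
      also have "(real a + 1) / real (q n) - (real a + (1 - ?d)) / real (q n) = ?d / real (q n)"
        by (subst diff_divide_distrib[symmetric]) simp
      finally show "emeasure lborel (?I a) = ennreal (?d / real (q n))" .
    qed
    also have "\<dots> = ennreal ?d"
      using d alpha_diff_pos[of n] by (simp add: ennreal_of_nat_eq_real_of_nat ennreal_mult[symmetric])
    also have "\<dots> \<le> ennreal ((1 / 2) ^ n)"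
    proof (rule ennreal_leI)
      have "?d \<le> 1 / real (q n)" by (rule q_alpha_diff_le)
      also have "real (2 ^ n) \<le> real (q n)" using q_ge_pow[of n] by (rule of_nat_mono)
      hence "1 / real (q n) \<le> 1 / real (2 ^ n)" by (intro divide_left_mono) auto
      finally show "?d \<le> (1 / 2) ^ n" by (simp add: power_divide)
    qed
    finally show ?thesis by (simp add: emeasure_eq_measure)
  qed
  have "summable (\<lambda>n. measure circle_lebesgue (?A n))"
  proof (rule summable_comparison_test')
    show "summable (\<lambda>n. (1 / 2 :: real) ^ n)" by (rule summable_geometric) simp
  qed (use bound in auto)
  from borel_cantelli_AE1[OF A _ this]
  have "AE \<theta> in circle_lebesgue. eventually (\<lambda>n. \<theta> \<in> space circle_lebesgue - ?A n) sequentially"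
    by (simp add: emeasure_eq_measure)
  thus ?thesis by (rule AE_mp) (auto intro!: AE_I2 elim: eventually_mono)
qed

lemma AE_Y0: "AE \<theta> in circle_lebesgue. \<theta> \<in> Y0"
  using AE_deep AE_no_carry AE_space by eventually_elim (auto simp: Y0_def)


subsection \<open>The isomorphism\<close>

text \<open>Imposing the condition along the whole forward orbit makes the set forward invariant; as
  a countable intersection it keeps full measure.\<close>

definition Y :: "real set" where
  "Y = {\<theta>\<in>{0..<1}. \<forall>s. (rot alpha ^^ s) \<theta> \<in> Y0}"

lemma Y_sets: "Y \<in> sets circle_lebesgue"
proof -
  have [measurable]: "(rot alpha ^^ s) \<in> borel_measurable borel" for s
    by (induction s) (auto intro: measurable_comp simp: id_def)
  have "Y \<in> sets borel" unfolding Y_def by measurable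
  thus ?thesis by (auto simp: sets_circle_lebesgue Y_def)
qed

lemma AE_Y: "AE \<theta> in circle_lebesgue. \<theta> \<in> Y"
proof -
  have "AE \<theta> in circle_lebesgue. \<forall>s. (rot alpha ^^ s) \<theta> \<in> Y0"
    unfolding AE_all_countable using AE_rot_iterate[OF AE_Y0] by blast
  thus ?thesis using AE_space by eventually_elim (auto simp: Y_def)
qed

lemma Y_subset: "Y \<subseteq> Y0" "Y \<subseteq> {0..<1}"
  unfolding Y_def by (auto dest: spec[of _ 0])

lemma rot_Y: "\<theta> \<in> Y \<Longrightarrow> rot alpha \<theta> \<in> Y"
proof -
  assume \<theta>: "\<theta> \<in> Y"
  have "(rot alpha ^^ s) (rot alpha \<theta>) = (rot alpha ^^ Suc s) \<theta>" for s
    by (simp add: funpow_Suc_right del: funpow.simps)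
  moreover have "(rot alpha ^^ Suc s) \<theta> \<in> Y0" for s using \<theta> unfolding Y_def by blast
  moreover have "rot alpha \<theta> \<in> {0..<1}" by (simp add: rot_def frac_lt_1)
  ultimately show ?thesis unfolding Y_def by simp
qed

lemma Y_nonempty: "Y \<noteq> {}"
proof
  assume "Y = {}"
  hence "AE \<theta> in circle_lebesgue. False" using AE_Y by simp
  thus False using prob_space.AE_False[OF prob_space_circle_lebesgue] by simp
qed

text \<open>The map \<open>coding\<close> need not land in the circle factor off the full-measure set Y, so it is redefined there.\<close>

definition coding' :: "real \<Rightarrow> int \<Rightarrow> sym" where
  "coding' \<theta> = (if \<theta> \<in> Y then coding \<theta> else coding (SOME y. y \<in> Y))"

abbreviation "borel_K \<equiv> restrict_space (borel :: (int \<Rightarrow> sym) measure) (circle_factor k l)"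

lemma space_borel_K: "space borel_K = circle_factor k l"
  by (simp add: space_restrict_space)

lemma coding'_measurable: "coding' \<in> measurable circle_lebesgue borel_K"
proof (rule measurable_restrict_space2)
  have "(SOME y. y \<in> Y) \<in> Y" using Y_nonempty by (simp add: some_in_eq)
  thus "coding' \<in> space circle_lebesgue \<rightarrow> circle_factor k l"
    using coding_in_K[OF subsetD[OF Y_subset(1)]] by (auto simp: coding'_def)
  show "coding' \<in> measurable circle_lebesgue borel"
    unfolding coding'_def[abs_def] using Y_sets
    by (intro measurable_If_set measurable_circle_lebesgueI coding_measurable measurable_const) (auto simp: Int_absorb2 Y_subset)
qed

lemma sh_measurable_borel_K: "sh \<in> measurable borel_K borel_K"
  by (intro measurable_restrict_space3 sh_measurable) (auto intro: sh_circle_factor)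

section \<open>The image of Lebesgue measure on the circle factor\<close>

definition nu0 :: "(int \<Rightarrow> sym) measure" where
  "nu0 = distr circle_lebesgue borel_K coding'"

lemma space_nu0: "space nu0 = circle_factor k l" and sets_nu0: "sets nu0 = sets borel_K"
  by (simp_all add: nu0_def space_borel_K)

lemma emeasure_nu0: "A \<in> sets borel_K \<Longrightarrow> emeasure nu0 A = emeasure circle_lebesgue (coding' -` A \<inter> {0..<1})"
  unfolding nu0_def using coding'_measurable by (simp add: emeasure_distr)

text \<open>A fibre of the coding contains, up to a null set, only the decoded point, so there are
  no atoms. Invariance follows from that of Lebesgue measure, since shift and rotation are
  intertwined almost everywhere.\<close>

lemma circle_measure_nu0: "circle_measure k l nu0"
  unfolding circle_measure_def
proof (intro conjI ballI)
  show "prob_space nu0" unfolding nu0_def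
    by (rule prob_space.prob_space_distr[OF prob_space_circle_lebesgue coding'_measurable])
  show "space nu0 = circle_factor k l" "sets nu0 = sets borel_K" by (simp_all add: space_nu0 sets_nu0)
  show "emeasure nu0 {x} = 0" for x
  \<comment> \<open>The case split replaces a proof that singletons are measurable:
    \<open>emeasure\<close> is 0 by convention on other sets.\<close>
  proof (cases "{x} \<in> sets borel_K")
    case True
    have "AE \<theta> in lborel. \<theta> \<noteq> decoding x" by (rule AE_lborel_singleton)
    hence ne: "AE \<theta> in circle_lebesgue. \<theta> \<noteq> decoding x"
      unfolding circle_lebesgue_def by (subst AE_restrict_space_iff) auto
    have "AE \<theta> in circle_lebesgue. coding' \<theta> \<noteq> x"
      using AE_Y ne by eventually_elim (use decoding_coding Y_subset in \<open>auto simp: coding'_def\<close>)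
    hence "emeasure circle_lebesgue (coding' -` {x} \<inter> {0..<1}) = emeasure circle_lebesgue {}"
      using measurable_sets[OF coding'_measurable True] by (intro emeasure_eq_AE) auto
    thus ?thesis using emeasure_nu0[OF True] by simp
  next
    case False
    thus ?thesis by (intro emeasure_notin_sets) (simp add: sets_nu0)
  qed
  show "measure_preserving_map nu0 sh"
    unfolding measure_preserving_map_def
  proof
    have eq: "measurable nu0 nu0 = measurable borel_K borel_K" by (intro measurable_cong_sets) (simp_all add: sets_nu0)
    show "sh \<in> measurable nu0 nu0" unfolding eq by (rule sh_measurable_borel_K)
    have "distr nu0 nu0 sh = distr nu0 borel_K sh" by (rule distr_cong) (simp_all add: sets_nu0)
    also have "\<dots> = distr circle_lebesgue borel_K (sh \<circ> coding')"
      unfolding nu0_def by (rule distr_distr[OF sh_measurable_borel_K coding'_measurable])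
    also have "\<dots> = distr circle_lebesgue borel_K (coding' \<circ> rot alpha)"
    proof (rule distr_cong_AE)
      show "AE \<theta> in circle_lebesgue. (sh \<circ> coding') \<theta> = (coding' \<circ> rot alpha) \<theta>"
        using AE_Y by eventually_elim (use coding_rot Y_subset rot_Y in \<open>auto simp: coding'_def\<close>)
    qed (auto intro: measurable_comp coding'_measurable sh_measurable_borel_K rot_measurable_circle)
    also have "\<dots> = distr (distr circle_lebesgue circle_lebesgue (rot alpha)) borel_K coding'"
      by (rule distr_distr[OF coding'_measurable rot_measurable_circle, symmetric])
    finally show "distr nu0 nu0 sh = nu0" by (simp add: distr_rot nu0_def)
  qed
qed

lemma isomorphic_nu0: "mt_isomorphic nu0 sh circle_lebesgue (rot alpha)"
proof -
  \<comment> \<open>This is the image of Y under \<open>coding\<close>, described by conditions on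
    Borel functions so that its measurability is direct.\<close>
  define X where "X = {x \<in> circle_factor k l. decoding x \<in> Y \<and> coding (decoding x) = x}"
  have YB: "Y \<in> sets borel" using Y_sets by (simp add: sets_circle_lebesgue)
  have [measurable]: "Measurable.pred borel (\<lambda>x. decoding x \<in> Y)" using YB by measurable
  have [measurable]: "Measurable.pred borel (\<lambda>x. coding (decoding x) s = x s)" for s
  proof -
    have [measurable]: "(\<lambda>x. coding (decoding x) s) \<in> measurable borel (count_space UNIV)"
      by (rule measurable_compose[OF measurable_compose[OF decoding_measurable coding_measurable] measurable_coord])
    show ?thesis by measurable
  qed
  \<comment> \<open>Equality of sequences is spelled out as countably many conditions on
    coordinates.\<close>
  have XB: "{x. decoding x \<in> Y \<and> (\<forall>s. coding (decoding x) s = x s)} \<in> sets borel" by measurable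
  have X_eq: "X = circle_factor k l \<inter> {x. decoding x \<in> Y \<and> (\<forall>s. coding (decoding x) s = x s)}"
    unfolding X_def fun_eq_iff by blast
  have X_sets: "X \<in> sets nu0"
    unfolding sets_nu0 sets_restrict_space X_eq by (rule imageI[OF XB])
  have coding_X: "coding \<theta> \<in> X" if "\<theta> \<in> Y" for \<theta>
    using that decoding_coding coding_in_K Y_subset by (auto simp: X_def)
  have decoding_Y: "decoding x \<in> Y" "coding (decoding x) = x" if "x \<in> X" for x using that by (auto simp: X_def)
  have AE_X: "AE \<theta> in circle_lebesgue. coding' \<theta> \<in> X"
    using AE_Y by eventually_elim (auto simp: coding'_def coding_X)
  show ?thesis
    unfolding mt_isomorphic_def
  proof (intro exI conjI ballI)
    show "X \<in> sets nu0" "Y \<in> sets circle_lebesgue" by (fact X_sets Y_sets)+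
    have "emeasure circle_lebesgue (space circle_lebesgue - Y) = emeasure circle_lebesgue {}"
      using AE_Y by (intro emeasure_eq_AE sets.compl_sets[OF Y_sets]) auto
    thus "emeasure circle_lebesgue (space circle_lebesgue - Y) = 0" by simp
    have c: "space nu0 - X \<in> sets borel_K" using X_sets sets_nu0 by (metis sets.compl_sets)
    have "emeasure circle_lebesgue (coding' -` (space nu0 - X) \<inter> {0..<1}) = emeasure circle_lebesgue {}"
      using AE_X measurable_sets[OF coding'_measurable c] by (intro emeasure_eq_AE) auto
    thus "emeasure nu0 (space nu0 - X) = 0" using emeasure_nu0[OF c] by simp
    show "rot alpha ` Y \<subseteq> Y" using rot_Y by auto
    have sh_X: "sh x = coding (rot alpha (decoding x))" if "x \<in> X" for x
      using coding_rot[of "decoding x"] decoding_Y[OF that] Y_subset by auto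
    show "sh ` X \<subseteq> X" using sh_X coding_X rot_Y decoding_Y(1) by auto
    show bij: "bij_betw decoding X Y"
      by (rule bij_betw_byWitness[where f'=coding]) (use decoding_Y coding_X decoding_coding Y_subset in auto)
    have XK: "X \<subseteq> circle_factor k l" by (auto simp: X_def)
    have eqX: "sets (restrict_space nu0 X) = sets (restrict_space borel X)"
      unfolding sets_restrict_space sets_nu0 image_image using XK
      by (intro image_cong refl) auto
    have eqY: "sets (restrict_space circle_lebesgue Y) = sets (restrict_space borel Y)"
      unfolding circle_lebesgue_def sets_restrict_space image_image using Y_subset
      by (intro image_cong) auto
    have decoding_m: "decoding \<in> measurable (restrict_space borel X) (restrict_space borel Y)"
      by (intro measurable_restrict_space3 decoding_measurable) (use decoding_Y in auto)
    show decoding_m': "decoding \<in> measurable (restrict_space nu0 X) (restrict_space circle_lebesgue Y)"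
      using decoding_m measurable_cong_sets[OF eqX eqY] by simp
    have coding_m: "coding \<in> measurable (restrict_space borel Y) (restrict_space borel X)"
      by (intro measurable_restrict_space3 coding_measurable) (use coding_X in auto)
    have "coding \<in> measurable (restrict_space circle_lebesgue Y) (restrict_space nu0 X)"
      using coding_m measurable_cong_sets[OF eqY eqX] by simp
    moreover have "the_inv_into X decoding y = coding y" if "y \<in> Y" for y
      using that decoding_coding coding_X Y_subset bij by (intro the_inv_into_f_eq) (auto simp: bij_betw_def)
    ultimately show "the_inv_into X decoding \<in> measurable (restrict_space circle_lebesgue Y) (restrict_space nu0 X)"
      by (subst measurable_cong[where g=coding]) (auto simp: space_restrict_space)
    show "decoding (sh x) = rot alpha (decoding x)" if "x \<in> X" for x
      using sh_X[OF that] decoding_coding rot_Y decoding_Y(1)[OF that] Y_subset by auto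
    show "distr (restrict_space nu0 X) (restrict_space circle_lebesgue Y) decoding = restrict_space circle_lebesgue Y"
    proof (rule measure_eqI)
      fix A assume "A \<in> sets (distr (restrict_space nu0 X) (restrict_space circle_lebesgue Y) decoding)"
      hence A: "A \<in> sets (restrict_space circle_lebesgue Y)" by simp
      hence A': "A \<subseteq> Y" "A \<in> sets circle_lebesgue" 
        using sets_restrict_space_iff[of Y circle_lebesgue] sets.Int[OF Y_sets sets.top] by auto
      let ?B = "decoding -` A \<inter> X"
      have spX: "space (restrict_space nu0 X) = X" using X_sets by simp
      have "?B \<in> sets (restrict_space nu0 X)" using measurable_sets[OF decoding_m' A] spX by simp
      hence B: "?B \<in> sets borel_K" 
        using sets_restrict_space_iff[of X nu0] sets.Int[OF X_sets sets.top] by (auto simp: sets_nu0)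
      have "emeasure (distr (restrict_space nu0 X) (restrict_space circle_lebesgue Y) decoding) A
          = emeasure (restrict_space nu0 X) ?B"
        using decoding_m' A by (simp add: emeasure_distr spX)
      also have "\<dots> = emeasure nu0 ?B" using X_sets by (intro emeasure_restrict_space) auto
      also have "\<dots> = emeasure circle_lebesgue (coding' -` ?B \<inter> {0..<1})" by (rule emeasure_nu0[OF B])
      \<comment> \<open>On Y, which has full measure, \<open>decoding\<close> undoes
        \<open>coding'\<close>, so the two sets agree up to a null set.\<close>
      also have "\<dots> = emeasure circle_lebesgue A"
      proof (rule emeasure_eq_AE)
        show "AE \<theta> in circle_lebesgue. \<theta> \<in> coding' -` ?B \<inter> {0..<1} \<longleftrightarrow> \<theta> \<in> A"
          using AE_Y
        proof eventually_elim
          case (elim \<theta>)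
          thus ?case using coding_X[of \<theta>] decoding_coding[of \<theta>] Y_subset by (auto simp: coding'_def)
        qed
        show "coding' -` ?B \<inter> {0..<1} \<in> sets circle_lebesgue" using measurable_sets[OF coding'_measurable B] by simp
      qed (fact A'(2))
      also have "\<dots> = emeasure (restrict_space circle_lebesgue Y) A"
        by (rule emeasure_restrict_space[OF sets.Int[OF Y_sets sets.top] A'(1), symmetric])
      finally show "emeasure (distr (restrict_space nu0 X) (restrict_space circle_lebesgue Y) decoding) A
          = emeasure (restrict_space circle_lebesgue Y) A" .
    qed simp
  qed
qed

end

subsection \<open>Uniqueness of the measure\<close>

text \<open>The situation supplied by \<open>K_labels\<close> on one fixed window; all counting
  below uses only these local rules.\<close>

locale labelled_window =
  fixes v :: "sym list" and x :: "int \<Rightarrow> sym" and lab :: "int \<Rightarrow> nat option" and a b :: int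
  assumes v_ne: "v \<noteq> []"
    and ok: "\<And>t. a \<le> t \<Longrightarrow> t \<le> b \<Longrightarrow> label_ok v (x t, lab t)"
    and step: "\<And>t. a \<le> t \<Longrightarrow> t < b \<Longrightarrow> label_step v (x t, lab t) (x (t + 1), lab (t + 1))"
begin

lemma lab_less: "a \<le> t \<Longrightarrow> t \<le> b \<Longrightarrow> lab t = Some r \<Longrightarrow> r < length v \<and> x t = v ! r"
  using ok[of t] by (simp add: label_ok_def)

lemma lab_forward:
  assumes "a \<le> t" "lab t = Some r" "r + s < length v" "t + int s \<le> b"
  shows "lab (t + int s) = Some (r + s)"
  using assms(3,4)
proof (induction s)
  case (Suc s)
  hence "lab (t + int s) = Some (r + s)" by simp
  moreover have "label_step v (x (t + int s), lab (t + int s)) (x (t + int s + 1), lab (t + int s + 1))"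
    using Suc.prems assms(1) by (intro step) auto
  ultimately show ?case using Suc.prems by (simp add: label_step_def algebra_simps)
qed (use assms in simp)

lemma lab_backward:
  assumes "t \<le> b" "lab t = Some r" "s \<le> r" "a \<le> t - int s"
  shows "lab (t - int s) = Some (r - s)"
  using assms(3,4)
proof (induction s)
  case (Suc s)
  have IH: "lab (t - int s) = Some (r - s)" using Suc by simp
  let ?t = "t - int (Suc s)"
  have "label_step v (x ?t, lab ?t) (x (?t + 1), lab (?t + 1))"
    using Suc.prems assms(1) by (intro step) auto
  moreover have "?t + 1 = t - int s" by simp
  ultimately have "label_step v (x ?t, lab ?t) (x (t - int s), Some (r - s))" using IH by simp
  moreover have "r - s = Suc (r - Suc s)" using Suc.prems by simp
  ultimately show ?case by (auto simp: label_step_def split: option.splits if_splits)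
qed (use assms in simp)

text \<open>The sum telescopes with potential the partial sum of f up to the current label.\<close>

lemma label_sum_bound:
  fixes f :: "nat \<Rightarrow> real"
  assumes f0: "(\<Sum>r<length v. f r) = 0" and f1: "\<And>r. \<bar>f r\<bar> \<le> 1" and c: "a \<le> c" "c + int H \<le> b"
  shows "\<bar>\<Sum>i<H. case lab (c + int i) of None \<Rightarrow> 0 | Some r \<Rightarrow> f r\<bar> \<le> 2 * length v"
proof -
  define \<Phi> where "\<Phi> i = (case lab (c + int i) of None \<Rightarrow> 0 | Some r \<Rightarrow> \<Sum>j<r. f j)" for i
  have \<Phi>_le: "\<bar>\<Phi> i\<bar> \<le> length v" if "i \<le> H" for i
  proof (cases "lab (c + int i)")
    case (Some r)
    have "r < length v" using lab_less[OF _ _ Some] c that by auto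
    have "\<bar>\<Sum>j<r. f j\<bar> \<le> (\<Sum>j<r. \<bar>f j\<bar>)" by (rule sum_abs)
    also have "\<dots> \<le> (\<Sum>j<r. 1)" by (intro sum_mono f1)
    finally show ?thesis using \<open>r < length v\<close> Some by (simp add: \<Phi>_def)
  qed (simp add: \<Phi>_def)
  have "(case lab (c + int i) of None \<Rightarrow> 0 | Some r \<Rightarrow> f r) = \<Phi> (Suc i) - \<Phi> i" if "i < H" for i
  proof -
    let ?t = "c + int i"
    have st: "label_step v (x ?t, lab ?t) (x (?t + 1), lab (?t + 1))" using that c by (intro step) auto
    have e: "c + int (Suc i) = ?t + 1" by simp
    show ?thesis
    proof (cases "lab ?t")
      case None
      thus ?thesis using st unfolding \<Phi>_def e by (auto simp: label_step_def split: option.splits)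
    next
      case (Some r)
      have r: "r < length v" using lab_less[OF _ _ Some] c that by auto
      show ?thesis
      proof (cases "Suc r < length v")
        case True
        hence "lab (?t + 1) = Some (Suc r)" using st Some by (simp add: label_step_def)
        thus ?thesis using Some unfolding \<Phi>_def e by simp
      next
        \<comment> \<open>At the end of a copy the potential returns to 0. This agrees with adding
          \<open>f r\<close>, because f sums to 0 over a copy.\<close>
        case False
        hence "Suc r = length v" using r by simp
        hence "(\<Sum>j<r. f j) + f r = 0" using f0 by (metis sum.lessThan_Suc)
        moreover have "lab (?t + 1) = None \<or> lab (?t + 1) = Some 0" using st Some False by (simp add: label_step_def)
        hence "\<Phi> (Suc i) = 0" unfolding \<Phi>_def e by auto
        ultimately show ?thesis using Some unfolding \<Phi>_def[of i] by simp
      qed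
    qed
  qed
  hence "(\<Sum>i<H. case lab (c + int i) of None \<Rightarrow> 0 | Some r \<Rightarrow> f r) = (\<Sum>i<H. \<Phi> (Suc i) - \<Phi> i)"
    by (intro sum.cong) auto
  also have "\<dots> = \<Phi> H - \<Phi> 0" by (rule sum_lessThan_telescope)
  finally show ?thesis using \<Phi>_le[of H] \<Phi>_le[of 0] by linarith
qed

text \<open>The two ends of a copy are the places near which a window can fail to look like the
  periodic repetition of v.\<close>

definition mark :: "int \<Rightarrow> real" where
  "mark t = of_bool (lab t = Some 0 \<or> lab t = Some (length v - 1))"

text \<open>A copy carries at most two marks on \<open>length v\<close> letters. Subtracting the
  average makes the sum over a copy vanish, so \<open>label_sum_bound\<close> applies.\<close>

lemma mark_sum_bound:
  assumes c: "a \<le> c" "c + int H \<le> b"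
  shows "(\<Sum>i<H. mark (c + int i)) \<le> 2 * real H / length v + 2 * length v"
proof -
  let ?q = "length v"
  define g where "g r = (of_bool (r = 0 \<or> r = ?q - 1) :: real)" for r
  define C where "C = (\<Sum>r<?q. g r)"
  have q: "?q > 0" using v_ne by simp
  have "C \<le> (\<Sum>r<?q. of_bool (r = 0) + of_bool (r = ?q - 1))"
    unfolding C_def g_def by (intro sum_mono) auto
  also have "\<dots> = 2" using q by (simp add: sum.distrib of_bool_def)
  finally have C2: "C \<le> 2" .
  have "C \<le> (\<Sum>r<?q. 1)" unfolding C_def g_def by (intro sum_mono) auto
  hence Cq: "C / ?q \<le> 1" using q by simp
  have C0: "0 \<le> C / ?q" unfolding C_def g_def by (intro divide_nonneg_nonneg sum_nonneg) auto
  have "\<bar>\<Sum>i<H. case lab (c + int i) of None \<Rightarrow> 0 | Some r \<Rightarrow> g r - C / ?q\<bar> \<le> 2 * ?q"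
  proof (rule label_sum_bound[OF _ _ c])
    show "(\<Sum>r<?q. g r - C / ?q) = 0" using q by (simp add: sum_subtractf C_def)
    show "\<bar>g r - C / ?q\<bar> \<le> 1" for r using C0 Cq by (auto simp: g_def)
  qed
  \<comment> \<open>At a gap letter the left summand is minus the average, hence at most 0;
    elsewhere the summands agree.\<close>
  moreover have "(\<Sum>i<H. mark (c + int i) - C / ?q) \<le> (\<Sum>i<H. case lab (c + int i) of None \<Rightarrow> 0 | Some r \<Rightarrow> g r - C / ?q)"
    using C0 by (intro sum_mono) (auto simp: mark_def g_def split: option.splits)
  ultimately have "(\<Sum>i<H. mark (c + int i)) \<le> H * (C / ?q) + 2 * ?q" by (simp add: sum_subtractf)
  also have "H * (C / ?q) \<le> H * (2 / ?q)" using C2 by (intro mult_left_mono divide_right_mono) auto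
  finally show ?thesis by (simp add: mult.commute)
qed

end

text \<open>The window of length M at the origin has the form \<open>e\<^sup>c b\<^sup>d\<close>.\<close>

definition spacer_win :: "nat \<Rightarrow> (int \<Rightarrow> sym) \<Rightarrow> bool" where
  "spacer_win M x \<longleftrightarrow> (\<forall>s. 0 \<le> s \<and> s < int M \<longrightarrow> x s \<noteq> Star) \<and>
     (\<forall>s. 0 \<le> s \<and> s + 1 < int M \<longrightarrow> \<not> (x s = Bsym \<and> x (s + 1) = Esym))"

definition periodic :: "sym list \<Rightarrow> nat \<Rightarrow> int \<Rightarrow> sym" where
  "periodic v t s = v ! nat ((int t + s) mod int (length v))"

lemma funpow_sh: "(sh ^^ i) x = (\<lambda>s. x (s + int i))"
  by (induction i) (auto simp: sh_def algebra_simps)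

context labelled_window begin

text \<open>Farther than L from the ends of a copy, the orbit point and the periodic repetition
  agree on the window, and the error is 0. Near an end of a copy a mark is met. In a gap, either the
  gap fills the next M places or a copy begins there and supplies a mark.\<close>

lemma local_error:
  fixes Q :: "(int \<Rightarrow> sym) \<Rightarrow> bool" and F :: real
  assumes Q: "\<And>y z. (\<And>s. \<bar>s\<bar> \<le> int L \<Longrightarrow> y s = z s) \<Longrightarrow> Q y = Q z"
    and F: "0 \<le> F" "F \<le> 1"
    and t: "a \<le> int i - int L" "int i + int M + int L \<le> b"
  shows "\<bar>of_bool (Q ((sh ^^ i) x)) - F - (case lab (int i) of None \<Rightarrow> 0 | Some r \<Rightarrow> of_bool (Q (periodic v r)) - F)\<bar>
     \<le> of_bool (spacer_win M ((sh ^^ i) x)) + (\<Sum>d<M + 2 * L. mark (int i - int L + int d))"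
    (is "?lhs \<le> ?sp + ?E")
proof -
  let ?t = "int i"
  have mark_nn: "0 \<le> mark t" for t by (simp add: mark_def)
  have sp0: "(0 :: real) \<le> ?sp" by simp
  have E0: "0 \<le> ?E" by (intro sum_nonneg mark_nn)
  have E1: "1 \<le> ?E" if "mark (?t + d) = 1" "- int L \<le> d" "d < int M + int L" for d
  proof -
    have "mark (?t - int L + int (nat (d + int L))) \<le> ?E"
      using that by (intro member_le_sum mark_nn) auto
    thus ?thesis using that by simp
  qed
  show ?thesis
  proof (cases "lab ?t")
    case None
    have l1: "?lhs \<le> 1" using F None by auto
    show ?thesis
    proof (cases "\<forall>d<M. lab (?t + int d) = None")
      case True
      have N: "lab (s + ?t) = None" if "0 \<le> s" "s < int M" for s
        using True[rule_format, of "nat s"] that by (simp add: add.commute)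
      have "spacer_win M ((sh ^^ i) x)"
        unfolding spacer_win_def funpow_sh
      proof (intro conjI allI impI)
        fix s assume s: "0 \<le> s \<and> s < int M"
        hence "label_ok v (x (s + ?t), lab (s + ?t))" using t by (intro ok) auto
        thus "x (s + ?t) \<noteq> Star" using N[of s] s by (simp add: label_ok_def)
      next
        fix s assume s: "0 \<le> s \<and> s + 1 < int M"
        hence "label_step v (x (s + ?t), lab (s + ?t)) (x (s + ?t + 1), lab (s + ?t + 1))" using t by (intro step) auto
        moreover have "s + ?t + 1 = s + 1 + ?t" by simp
        ultimately show "\<not> (x (s + ?t) = Bsym \<and> x (s + 1 + ?t) = Esym)"
          using N[of s] N[of "s + 1"] s by (simp add: label_step_def)
      qed
      thus ?thesis using l1 E0 by simp
    next
      case False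
      \<comment> \<open>The first labelled place after the gap; the rule for neighbouring labels
        forces its label to be 0, hence a mark.\<close>
      define d where "d = (LEAST d. lab (?t + int d) \<noteq> None)"
      have d: "lab (?t + int d) \<noteq> None" "d < M"
        using False LeastI[of "\<lambda>d. lab (?t + int d) \<noteq> None"] Least_le[of "\<lambda>d. lab (?t + int d) \<noteq> None"]
        unfolding d_def by (auto intro: le_less_trans)
      have "d \<noteq> 0" using d(1) None by (cases d) auto
      then obtain d' where d': "d = Suc d'" by (cases d) auto
      have pre: "lab (?t + int d') = None" using not_less_Least[of d' "\<lambda>d. lab (?t + int d) \<noteq> None"] d' by (auto simp: d_def)
      have "label_step v (x (?t + int d'), lab (?t + int d')) (x (?t + int d' + 1), lab (?t + int d' + 1))"
        using t d d' by (intro step) auto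
      moreover have "?t + int d' + 1 = ?t + int d" using d' by simp
      ultimately have "lab (?t + int d) = Some 0" using pre d(1) by (auto simp: label_step_def)
      hence "1 \<le> ?E" using d(2) by (intro E1[of "int d"]) (auto simp: mark_def)
      thus ?thesis using l1 sp0 by linarith
    qed
  next
    case (Some r)
    have r: "r < length v" using lab_less[OF _ _ Some] t by auto
    have l1: "?lhs \<le> 1" using Some by auto
    consider "L \<le> r" "r + L < length v" | "r < L" | "r + L \<ge> length v" by linarith
    thus ?thesis
    proof cases
      case 1
      have "Q ((sh ^^ i) x) = Q (periodic v r)"
      proof (rule Q)
        fix s assume s: "\<bar>s\<bar> \<le> int L"
        have *: "x (?t + s) = v ! nat (int r + s)"
        proof (cases "0 \<le> s")
          case True
          have "lab (?t + int (nat s)) = Some (r + nat s)" using s t 1 True by (intro lab_forward[OF _ Some]) auto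
          hence "x (?t + int (nat s)) = v ! (r + nat s)" using lab_less[of "?t + int (nat s)"] s t True by auto
          thus ?thesis using True by (simp add: nat_add_distrib)
        next
          case False
          have "lab (?t - int (nat (- s))) = Some (r - nat (- s))" using s t 1 False by (intro lab_backward[OF _ Some]) auto
          hence "x (?t - int (nat (- s))) = v ! (r - nat (- s))" using lab_less[of "?t - int (nat (- s))"] s t False by auto
          moreover have "r - nat (- s) = nat (int r + s)" using False s 1 by linarith
          ultimately show ?thesis using False by simp
        qed
        have "(int r + s) mod int (length v) = int r + s" using s 1 by (intro mod_pos_pos_trivial) auto
        thus "(sh ^^ i) x s = periodic v r s" using * by (simp add: funpow_sh periodic_def add.commute)
      qed
      thus ?thesis using Some E0 by simp
    next
      case 2
      have "lab (?t - int r) = Some (r - r)" using t 2 by (intro lab_backward[OF _ Some]) auto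
      hence "1 \<le> ?E" using 2 by (intro E1[of "- int r"]) (auto simp: mark_def)
      thus ?thesis using l1 sp0 by linarith
    next
      case 3
      let ?s = "length v - 1 - r"
      have "lab (?t + int ?s) = Some (r + ?s)" using t 3 r by (intro lab_forward[OF _ Some]) auto
      hence "lab (?t + int ?s) = Some (length v - 1)" using r by simp
      hence "1 \<le> ?E" using 3 r by (intro E1[of "int ?s"]) (auto simp: mark_def)
      thus ?thesis using l1 sp0 by linarith
    qed
  qed
qed

end

section \<open>Frequencies along orbit segments\<close>

definition freq :: "sym list \<Rightarrow> ((int \<Rightarrow> sym) \<Rightarrow> bool) \<Rightarrow> real" where
  "freq v Q = (\<Sum>t<length v. of_bool (Q (periodic v t))) / length v"

lemma freq_bounds: "v \<noteq> [] \<Longrightarrow> 0 \<le> freq v Q" "v \<noteq> [] \<Longrightarrow> freq v Q \<le> 1"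
proof -
  show "0 \<le> freq v Q" unfolding freq_def by (intro divide_nonneg_nonneg sum_nonneg) auto
  assume "v \<noteq> []"
  moreover have "(\<Sum>t<length v. of_bool (Q (periodic v t))) \<le> (\<Sum>t<length v. 1 :: real)" by (intro sum_mono) auto
  ultimately show "freq v Q \<le> 1" unfolding freq_def by (simp add: divide_le_eq)
qed

text \<open>The errors of \<open>local_error\<close> are summed along the orbit. The main term is
  bounded by \<open>label_sum_bound\<close>, because the indicator minus its frequency sums to 0
  over a copy.\<close>

lemma (in labelled_window) orbit_count:
  assumes Q: "\<And>y z. (\<And>s. \<bar>s\<bar> \<le> int L \<Longrightarrow> y s = z s) \<Longrightarrow> Q y = Q z"
    and ab: "a = - int L" "b = int (N + M + L)"
  shows "\<bar>\<Sum>i<N. of_bool (Q ((sh ^^ i) x)) - freq v Q\<bar> \<le> (\<Sum>i<N. of_bool (spacer_win M ((sh ^^ i) x)))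
      + (2 * length v + (M + 2 * L) * (2 * real (N + M + 2 * L) / length v + 2 * length v))"
proof -
  let ?q = "length v" and ?F = "freq v Q" and ?D = "M + 2 * L"
  define G where "G i = (case lab (int i) of None \<Rightarrow> 0 | Some r \<Rightarrow> of_bool (Q (periodic v r)) - ?F)" for i
  have F: "0 \<le> ?F" "?F \<le> 1" using freq_bounds v_ne by auto
  have G: "\<bar>\<Sum>i<N. G i\<bar> \<le> 2 * ?q"
  proof -
    have "\<bar>\<Sum>i<N. case lab (0 + int i) of None \<Rightarrow> 0 | Some r \<Rightarrow> of_bool (Q (periodic v r)) - ?F\<bar> \<le> 2 * ?q"
    proof (rule label_sum_bound)
      show "(\<Sum>r<?q. of_bool (Q (periodic v r)) - ?F) = 0" using v_ne by (simp add: sum_subtractf freq_def)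
      show "\<bar>of_bool (Q (periodic v r)) - ?F\<bar> \<le> 1" for r using F by auto
    qed (use ab in auto)
    thus ?thesis by (simp add: G_def)
  qed
  have mark_nn: "0 \<le> mark t" for t by (simp add: mark_def)
  have "(\<Sum>i<N. \<Sum>d<?D. mark (int i - int L + int d)) = (\<Sum>d<?D. \<Sum>i<N. mark (int i - int L + int d))"
    by (rule sum.swap)
  \<comment> \<open>For each fixed d the marks of a shifted segment are counted, and every such
    segment lies in the common range of length N + \<open>?D\<close>.\<close>
  also have "\<dots> \<le> (\<Sum>d<?D. \<Sum>j<N + ?D. mark (- int L + int j))"
  proof (rule sum_mono)
    fix d assume d: "d \<in> {..<?D}"
    have "(\<Sum>i<N. mark (int i - int L + int d)) = (\<Sum>j\<in>(\<lambda>i. i + d) ` {..<N}. mark (- int L + int j))"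
      by (subst sum.reindex) (auto simp: algebra_simps)
    also have "\<dots> \<le> (\<Sum>j<N + ?D. mark (- int L + int j))"
      using d by (intro sum_mono2 mark_nn) auto
    finally show "(\<Sum>i<N. mark (int i - int L + int d)) \<le> (\<Sum>j<N + ?D. mark (- int L + int j))" .
  qed
  also have "\<dots> = ?D * (\<Sum>j<N + ?D. mark (- int L + int j))" by simp
  also have "\<dots> \<le> ?D * (2 * real (N + ?D) / ?q + 2 * ?q)"
    using ab by (intro mult_left_mono mark_sum_bound) auto
  finally have E: "(\<Sum>i<N. \<Sum>d<?D. mark (int i - int L + int d)) \<le> ?D * (2 * real (N + ?D) / ?q + 2 * ?q)" .
  have "\<bar>(\<Sum>i<N. of_bool (Q ((sh ^^ i) x)) - ?F) - (\<Sum>i<N. G i)\<bar>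
      \<le> (\<Sum>i<N. \<bar>of_bool (Q ((sh ^^ i) x)) - ?F - G i\<bar>)"
    unfolding sum_subtractf[symmetric] by (rule sum_abs)
  also have "\<dots> \<le> (\<Sum>i<N. of_bool (spacer_win M ((sh ^^ i) x)) + (\<Sum>d<?D. mark (int i - int L + int d)))"
    unfolding G_def using ab by (intro sum_mono local_error[OF Q F]) auto
  also have "\<dots> = (\<Sum>i<N. of_bool (spacer_win M ((sh ^^ i) x))) + (\<Sum>i<N. \<Sum>d<?D. mark (int i - int L + int d))"
    by (rule sum.distrib)
  finally show ?thesis using G E by (simp add: add.assoc)
qed

context circ_seq begin

section \<open>Invariant measures and long spacers\<close>

lemma circle_measure_sh:
  assumes "circle_measure k l \<nu>" "A \<in> sets \<nu>"
  shows "{x \<in> circle_factor k l. (sh ^^ i) x \<in> A} \<in> sets \<nu>"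
    and "measure \<nu> {x \<in> circle_factor k l. (sh ^^ i) x \<in> A} = measure \<nu> A"
proof -
  have sp: "space \<nu> = circle_factor k l" and m: "sh \<in> measurable \<nu> \<nu>" and d: "distr \<nu> \<nu> sh = \<nu>"
    using assms(1) by (auto simp: circle_measure_def measure_preserving_map_def)
  have one: "{x \<in> circle_factor k l. sh x \<in> B} \<in> sets \<nu> \<and> measure \<nu> {x \<in> circle_factor k l. sh x \<in> B} = measure \<nu> B"
    if "B \<in> sets \<nu>" for B
  proof -
    have e: "sh -` B \<inter> space \<nu> = {x \<in> circle_factor k l. sh x \<in> B}" by (auto simp: sp)
    show ?thesis using measurable_sets[OF m that] measure_distr[OF m that] unfolding d e by simp
  qed
  have "{x \<in> circle_factor k l. (sh ^^ i) x \<in> A} \<in> sets \<nu> \<and> measure \<nu> {x \<in> circle_factor k l. (sh ^^ i) x \<in> A} = measure \<nu> A"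
  proof (induction i)
    case 0
    have "{x \<in> circle_factor k l. x \<in> A} = A" using sets.sets_into_space[OF assms(2)] sp by auto
    thus ?case using assms(2) by simp
  next
    case (Suc i)
    have "{x \<in> circle_factor k l. (sh ^^ Suc i) x \<in> A} = {x \<in> circle_factor k l. sh x \<in> {x \<in> circle_factor k l. (sh ^^ i) x \<in> A}}"
      using sh_circle_factor by (auto simp: funpow_Suc_right simp del: funpow.simps)
    thus ?case using one[of "{x \<in> circle_factor k l. (sh ^^ i) x \<in> A}"] Suc by simp
  qed
  thus "{x \<in> circle_factor k l. (sh ^^ i) x \<in> A} \<in> sets \<nu>"
    "measure \<nu> {x \<in> circle_factor k l. (sh ^^ i) x \<in> A} = measure \<nu> A" by auto
qed

lemma circle_measure_setsI:
  assumes "circle_measure k l \<nu>" "Measurable.pred borel P"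
  shows "{x \<in> circle_factor k l. P x} \<in> sets \<nu>"
proof -
  have "{x. P x} \<in> sets borel" using assms(2) by (simp add: pred_def)
  moreover have "{x \<in> circle_factor k l. P x} = circle_factor k l \<inter> {x. P x}" by auto
  ultimately show ?thesis using assms(1) by (auto simp: circle_measure_def sets_restrict_space)
qed

lemma spacer_win_measurable: "Measurable.pred borel (spacer_win M)"
  unfolding spacer_win_def[abs_def] by measurable

text \<open>By invariance the measure does not depend on c. As c decreases to minus infinity, the
  sets shrink to at most one constant sequence, which has measure 0 by non-atomicity.\<close>

lemma eventually_constant_null:
  assumes \<nu>: "circle_measure k l \<nu>"
  shows "measure \<nu> {x \<in> circle_factor k l. \<forall>s\<ge>c. x s = y} = 0"
proof -
  interpret prob_space \<nu> using \<nu> by (simp add: circle_measure_def)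
  define U where "U c = {x \<in> circle_factor k l. \<forall>s\<ge>c. x s = y}" for c :: int
  have U: "U c \<in> sets \<nu>" for c unfolding U_def by (rule circle_measure_setsI[OF \<nu>]) measurable
  have eq: "measure \<nu> (U (c + int i)) = measure \<nu> (U c)" for c i
  proof -
    have "(sh ^^ i) x \<in> circle_factor k l" if "x \<in> circle_factor k l" for x
      using that by (induction i) (auto intro: sh_circle_factor)
    moreover have "(\<forall>s\<ge>c + int i. x s = y) \<longleftrightarrow> (\<forall>s\<ge>c. x (s + int i) = y)" for x :: "int \<Rightarrow> sym"
    proof safe
      fix s assume "\<forall>s\<ge>c. x (s + int i) = y" "c + int i \<le> s"
      from this(1)[rule_format, of "s - int i"] this(2) show "x s = y" by simp
    qed simp
    ultimately have "U (c + int i) = {x \<in> circle_factor k l. (sh ^^ i) x \<in> U c}"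
      unfolding U_def funpow_sh by blast
    thus ?thesis using circle_measure_sh(2)[OF \<nu> U] by simp
  qed
  have const: "measure \<nu> (U (- int i)) = measure \<nu> (U c)" for i
  proof -
    have "measure \<nu> (U (- int i)) = measure \<nu> (U 0)" using eq[of "- int i" i] by simp
    also have "\<dots> = measure \<nu> (U c)" using eq[of 0 "nat c"] eq[of c "nat (- c)"] by (cases "0 \<le> c") auto
    finally show ?thesis .
  qed
  have "(\<lambda>i. measure \<nu> (U (- int i))) \<longlonglongrightarrow> measure \<nu> (\<Inter>i. U (- int i))"
    using U by (intro finite_Lim_measure_decseq) (auto simp: decseq_def U_def)
  hence "measure \<nu> (U c) = measure \<nu> (\<Inter>i. U (- int i))"
    unfolding const using LIMSEQ_unique tendsto_const by blast
  also have "measure \<nu> (\<Inter>i. U (- int i)) = 0"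
  proof -
    have sub: "(\<Inter>i. U (- int i)) \<subseteq> {\<lambda>_. y} \<inter> circle_factor k l"
    proof
      fix x assume x: "x \<in> (\<Inter>i. U (- int i))"
      have "x s = y" for s using x[THEN INT_D, of "nat \<bar>s\<bar>"] by (auto simp: U_def)
      thus "x \<in> {\<lambda>_. y} \<inter> circle_factor k l" using x by (auto simp: U_def)
    qed
    show ?thesis
    proof (cases "(\<lambda>_. y) \<in> circle_factor k l \<and> (\<lambda>_. y) \<in> (\<Inter>i. U (- int i))")
      case True
      hence "(\<Inter>i. U (- int i)) = {\<lambda>_. y}" using sub by blast
      thus ?thesis using \<nu> True by (simp add: circle_measure_def measure_def)
    next
      case False
      hence "(\<Inter>i. U (- int i)) = {}" using sub by blast
      thus ?thesis by simp
    qed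
  qed
  finally show ?thesis by (simp add: U_def)
qed

text \<open>The sets decrease to those points whose right half-line has no star and no b followed by
  e. Such a half-line is all e, or all b from some place on, so countably many null sets cover the
  limit.\<close>

lemma spacer_win_tendsto:
  assumes \<nu>: "circle_measure k l \<nu>"
  shows "(\<lambda>M. measure \<nu> {x \<in> circle_factor k l. spacer_win M x}) \<longlonglongrightarrow> 0"
proof -
  interpret prob_space \<nu> using \<nu> by (simp add: circle_measure_def)
  define A where "A M = {x \<in> circle_factor k l. spacer_win M x}" for M
  have A: "A M \<in> sets \<nu>" for M unfolding A_def by (rule circle_measure_setsI[OF \<nu> spacer_win_measurable])
  have lim: "(\<lambda>M. measure \<nu> (A M)) \<longlonglongrightarrow> measure \<nu> (\<Inter>M. A M)"
    using A by (intro finite_Lim_measure_decseq) (auto simp: decseq_def A_def spacer_win_def)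
  define U where "U c y = {x \<in> circle_factor k l. \<forall>s\<ge>c. x s = y}" for c :: int and y
  have U: "U c y \<in> sets \<nu>" for c y unfolding U_def by (rule circle_measure_setsI[OF \<nu>]) measurable
  have U0: "U c y \<in> null_sets \<nu>" for c y
    using eventually_constant_null[OF \<nu>, of c y] U by (simp add: null_sets_def emeasure_eq_measure U_def)
  have "(\<Inter>M. A M) \<subseteq> U 0 Esym \<union> (\<Union>c. U c Bsym)"
  proof
    fix x assume x: "x \<in> (\<Inter>M. A M)"
    have sw: "spacer_win M x" for M using x by (auto simp: A_def)
    have K: "x \<in> circle_factor k l" using x by (auto simp: A_def)
    have ns: "x s \<noteq> Star" if "0 \<le> s" for s
      using sw[of "nat s + 1"] that unfolding spacer_win_def by auto
    have nbe: "\<not> (x s = Bsym \<and> x (s + 1) = Esym)" if "0 \<le> s" for s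
      using sw[of "nat s + 2"] that unfolding spacer_win_def by auto
    show "x \<in> U 0 Esym \<union> (\<Union>c. U c Bsym)"
    proof (cases "\<exists>c\<ge>0. x c = Bsym")
      case True
      then obtain c where c: "0 \<le> c" "x c = Bsym" by blast
      have "x s = Bsym" if "s \<ge> c" for s
        using that
      proof (induction s rule: int_ge_induct)
        case (step s)
        thus ?case using ns[of "s + 1"] nbe[of s] c by (cases "x (s + 1)") auto
      qed (use c in simp)
      thus ?thesis using K by (auto simp: U_def)
    next
      case False
      have "x s = Esym" if "0 \<le> s" for s using ns[OF that] False that by (cases "x s") auto
      thus ?thesis using K by (auto simp: U_def)
    qed
  qed
  moreover have "U 0 Esym \<union> (\<Union>c. U c Bsym) \<in> null_sets \<nu>" using U0 by (intro null_sets.Un null_sets_UN) auto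
  moreover have "(\<Inter>M. A M) \<in> sets \<nu>" using A by auto
  ultimately have "(\<Inter>M. A M) \<in> null_sets \<nu>" using null_sets_subset by blast
  hence "measure \<nu> (\<Inter>M. A M) = 0" by (simp add: null_sets_def measure_def)
  thus ?thesis using lim by (simp add: A_def)
qed

text \<open>\<open>orbit_count\<close> is integrated over \<nu>. By invariance all terms of each
  orbit sum have the same integral, so dividing by the length and letting it grow leaves only the
  part linear in the length.\<close>

lemma measure_near_freq:
  assumes \<nu>: "circle_measure k l \<nu>" and S: "S \<in> sets \<nu>" and l2: "\<And>i. i \<ge> n \<Longrightarrow> l i \<ge> 2"
    and QS: "\<And>x. x \<in> circle_factor k l \<Longrightarrow> Q x \<longleftrightarrow> x \<in> S"
    and Q: "\<And>y z. (\<And>s. \<bar>s\<bar> \<le> int L \<Longrightarrow> y s = z s) \<Longrightarrow> Q y = Q z"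
  shows "\<bar>measure \<nu> S - freq (w n) Q\<bar>
     \<le> measure \<nu> {x \<in> circle_factor k l. spacer_win M x} + 2 * real (M + 2 * L) / q n"
proof -
  interpret prob_space \<nu> using \<nu> by (simp add: circle_measure_def)
  let ?K = "circle_factor k l" and ?F = "freq (w n) Q" and ?D = "real (M + 2 * L)"
  define SP where "SP = {x \<in> ?K. spacer_win M x}"
  have sp: "space \<nu> = ?K" using \<nu> by (simp add: circle_measure_def)
  have SPs: "SP \<in> sets \<nu>" unfolding SP_def by (rule circle_measure_setsI[OF \<nu> spacer_win_measurable])
  have wne: "w n \<noteq> []" using length_w[of n] q_nonzero(1)[of n] by (metis list.size(3))
  have shK: "(sh ^^ i) x \<in> ?K" if "x \<in> ?K" for i x using that by (induction i) (auto intro: sh_circle_factor)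
  define Bd where "Bd N = 2 * real (q n) + ?D * (2 * real (N + M + 2 * L) / q n + 2 * q n)" for N
  have bound: "\<bar>real N * (measure \<nu> S - ?F)\<bar> \<le> real N * measure \<nu> SP + Bd N" for N
  proof -
    let ?A = "\<lambda>i. {x \<in> ?K. (sh ^^ i) x \<in> S}" and ?B = "\<lambda>i. {x \<in> ?K. (sh ^^ i) x \<in> SP}"
    have As: "?A i \<in> sets \<nu>" "measure \<nu> (?A i) = measure \<nu> S" for i by (rule circle_measure_sh[OF \<nu> S])+
    have Bs: "?B i \<in> sets \<nu>" "measure \<nu> (?B i) = measure \<nu> SP" for i by (rule circle_measure_sh[OF \<nu> SPs])+
    let ?g = "\<lambda>x. \<Sum>i<N. indicator (?A i) x - ?F" and ?h = "\<lambda>x. (\<Sum>i<N. indicator (?B i) x) + Bd N"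
    have intA: "integrable \<nu> (indicator (?A i) :: _ \<Rightarrow> real)" for i using As(1) by (auto simp: emeasure_eq_measure)
    have intB: "integrable \<nu> (indicator (?B i) :: _ \<Rightarrow> real)" for i using Bs(1) by (auto simp: emeasure_eq_measure)
    \<comment> \<open>The labelling enters only pointwise and may be chosen separately for each x;
      the resulting bound speaks of measurable sets alone.\<close>
    have pt: "\<bar>?g x\<bar> \<le> ?h x" if x: "x \<in> ?K" for x
    proof -
      obtain lab where lab: "\<And>t. - int L \<le> t \<Longrightarrow> t \<le> int (N + M + L) \<Longrightarrow> label_ok (w n) (x t, lab t)"
        "\<And>t. - int L \<le> t \<Longrightarrow> t < int (N + M + L) \<Longrightarrow> label_step (w n) (x t, lab t) (x (t + 1), lab (t + 1))"
        using K_labels[OF x l2, where a="- int L" and b="int (N + M + L)"] by blast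
      interpret labelled_window "w n" x lab "- int L" "int (N + M + L)"
        using lab wne by unfold_locales
      have "\<bar>\<Sum>i<N. of_bool (Q ((sh ^^ i) x)) - ?F\<bar> \<le> (\<Sum>i<N. of_bool (spacer_win M ((sh ^^ i) x))) + Bd N"
      proof (rule order_trans[OF orbit_count[where Q=Q and L=L and N=N and M=M, OF _ refl refl]])
        show "Q y = Q z" if "\<And>s. \<bar>s\<bar> \<le> int L \<Longrightarrow> y s = z s" for y z by (rule Q[OF that])
      qed (simp add: Bd_def length_w add.assoc)
      moreover have "of_bool (Q ((sh ^^ i) x)) = (indicator (?A i) x :: real)" for i
        using x shK[OF x, of i] QS by (auto simp: indicator_def)
      moreover have "of_bool (spacer_win M ((sh ^^ i) x)) = (indicator (?B i) x :: real)" for i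
        using x shK[OF x, of i] by (auto simp: indicator_def SP_def)
      ultimately show ?thesis by simp
    qed
    have ig: "integrable \<nu> ?g" using intA by (intro Bochner_Integration.integrable_sum Bochner_Integration.integrable_diff) auto
    have ih: "integrable \<nu> ?h" using intB by (intro Bochner_Integration.integrable_add Bochner_Integration.integrable_sum) auto
    have "integral\<^sup>L \<nu> ?g = (\<Sum>i<N. measure \<nu> S - ?F)"
      using intA As by (subst Bochner_Integration.integral_sum) (auto simp: prob_space intro!: sum.cong)
    also have "\<dots> = real N * (measure \<nu> S - ?F)" by simp
    finally have 1: "integral\<^sup>L \<nu> ?g = real N * (measure \<nu> S - ?F)" .
    have "integral\<^sup>L \<nu> ?h = (\<Sum>i<N. measure \<nu> SP) + Bd N"
      using intB Bs by (subst Bochner_Integration.integral_add) (auto simp: prob_space intro!: sum.cong)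
    hence 2: "integral\<^sup>L \<nu> ?h = real N * measure \<nu> SP + Bd N" by simp
    have "\<bar>integral\<^sup>L \<nu> ?g\<bar> \<le> (\<integral>x. \<bar>?g x\<bar> \<partial>\<nu>)" by (rule integral_abs_bound)
    also have "\<dots> \<le> integral\<^sup>L \<nu> ?h" using ig ih pt sp by (intro integral_mono) auto
    finally show ?thesis using 1 2 by simp
  qed
  \<comment> \<open>The part of \<open>Bd\<close> that does not grow with the length of the orbit
    segment.\<close>
  define C where "C = 2 * real (q n) + ?D * (2 * ?D / q n + 2 * q n)"
  have "\<bar>measure \<nu> S - ?F\<bar> \<le> measure \<nu> SP + 2 * ?D / q n + C * (1 / real (Suc N))" for N
  proof -
    let ?N = "real (Suc N)"
    have BdC: "Bd (Suc N) = ?N * (2 * ?D / q n) + C"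
      by (simp add: Bd_def C_def add_divide_distrib algebra_simps)
    have "?N * \<bar>measure \<nu> S - ?F\<bar> \<le> ?N * measure \<nu> SP + (?N * (2 * ?D / q n) + C)"
      using bound[of "Suc N"] unfolding BdC abs_mult by simp
    also have "\<dots> = ?N * (measure \<nu> SP + 2 * ?D / q n + C * (1 / ?N))" by (simp add: field_simps del: of_nat_Suc)
    finally show ?thesis by (subst (asm) mult_le_cancel_left_pos) auto
  qed
  moreover have "(\<lambda>N. measure \<nu> SP + 2 * ?D / q n + C * (1 / real (Suc N))) \<longlonglongrightarrow> measure \<nu> SP + 2 * ?D / q n + C * 0"
    by (intro tendsto_intros) (use LIMSEQ_inverse_real_of_nat in \<open>simp add: inverse_eq_divide\<close>)
  ultimately have "\<bar>measure \<nu> S - ?F\<bar> \<le> measure \<nu> SP + 2 * ?D / q n + C * 0"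
    by (intro LIMSEQ_le_const) auto
  thus ?thesis by (simp add: SP_def)
qed

section \<open>Generating sets and uniqueness\<close>

definition local_sets :: "(int \<Rightarrow> sym) set set" where
  "local_sets = {S \<in> sets borel_K. \<exists>L. \<forall>x\<in>circle_factor k l. \<forall>y\<in>circle_factor k l.
     (\<forall>s. \<bar>s\<bar> \<le> int L \<longrightarrow> x s = y s) \<longrightarrow> (x \<in> S \<longleftrightarrow> y \<in> S)}"

lemma local_setsE:
  assumes "S \<in> local_sets"
  obtains L where "\<And>x y. x \<in> circle_factor k l \<Longrightarrow> y \<in> circle_factor k l \<Longrightarrow>
      (\<And>s. \<bar>s\<bar> \<le> int L \<Longrightarrow> x s = y s) \<Longrightarrow> (x \<in> S \<longleftrightarrow> y \<in> S)"
  using assms unfolding local_sets_def by blast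

lemma Int_stable_local_sets: "Int_stable local_sets"
proof (rule Int_stableI)
  fix A B assume AB: "A \<in> local_sets" "B \<in> local_sets"
  obtain L where L: "\<And>x y. x \<in> circle_factor k l \<Longrightarrow> y \<in> circle_factor k l \<Longrightarrow>
      (\<And>s. \<bar>s\<bar> \<le> int L \<Longrightarrow> x s = y s) \<Longrightarrow> (x \<in> A \<longleftrightarrow> y \<in> A)" using local_setsE[OF AB(1)] by blast
  obtain L' where L': "\<And>x y. x \<in> circle_factor k l \<Longrightarrow> y \<in> circle_factor k l \<Longrightarrow>
      (\<And>s. \<bar>s\<bar> \<le> int L' \<Longrightarrow> x s = y s) \<Longrightarrow> (x \<in> B \<longleftrightarrow> y \<in> B)" using local_setsE[OF AB(2)] by blast
  have "x \<in> A \<inter> B \<longleftrightarrow> y \<in> A \<inter> B" if "x \<in> circle_factor k l" "y \<in> circle_factor k l" "\<forall>s. \<bar>s\<bar> \<le> int (max L L') \<longrightarrow> x s = y s" for x y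
    using L[OF that(1,2)] L'[OF that(1,2)] that(3) by auto
  moreover have "A \<inter> B \<in> sets borel_K" using AB by (auto simp: local_sets_def)
  ultimately show "A \<inter> B \<in> local_sets" unfolding local_sets_def by blast
qed

text \<open>Conditions on a single coordinate are local, and they already generate the product Borel
  structure.\<close>

lemma sets_borel_K_eq: "sets borel_K = sigma_sets (circle_factor k l) local_sets"
proof
  have "sigma_sets (space borel_K) local_sets \<subseteq> sets borel_K"
    by (rule sets.sigma_sets_subset) (auto simp: local_sets_def)
  thus "sigma_sets (circle_factor k l) local_sets \<subseteq> sets borel_K" by (simp add: space_borel_K)
  let ?M = "sigma (circle_factor k l) local_sets"
  have pow: "local_sets \<subseteq> Pow (circle_factor k l)"
    using sets.sets_into_space[of _ borel_K] by (auto simp: local_sets_def space_borel_K)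
  have sM: "space ?M = circle_factor k l" "sets ?M = sigma_sets (circle_factor k l) local_sets"
    using pow by (simp_all add: space_measure_of sets_measure_of)
  have "(\<lambda>x. x) \<in> measurable ?M borel"
  proof (rule borel_measurable_seqI)
    fix s
    have "{x \<in> circle_factor k l. x s \<in> T} \<in> local_sets" for T
    proof -
      have "{x. x s \<in> T} \<in> sets borel" using measurable_sets_borel[OF measurable_coord, of T s] by (simp add: vimage_def)
      hence "{x \<in> circle_factor k l. x s \<in> T} \<in> sets borel_K"
        unfolding sets_restrict_space by (rule rev_image_eqI) auto
      thus ?thesis unfolding local_sets_def by (auto intro!: exI[of _ "nat \<bar>s\<bar>"])
    qed
    hence "{x \<in> circle_factor k l. x s \<in> T} \<in> sets ?M" for T using sM(2) by auto
    thus "(\<lambda>x. x s) \<in> measurable ?M (count_space UNIV)"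
      by (intro measurableI) (auto simp: sM(1) vimage_def Int_def conj_commute)
  qed
  from measurable_sets[OF this] show "sets borel_K \<subseteq> sigma_sets (circle_factor k l) local_sets"
    unfolding sets_restrict_space sM by (auto simp: Int_commute)
qed

text \<open>On a local set both measures are close to the same frequency in \<open>w n\<close>;
  local sets form an intersection-stable generator.\<close>

lemma circle_measure_unique:
  assumes \<nu>: "circle_measure k l \<nu>" and \<mu>: "circle_measure k l \<mu>"
  shows "\<nu> = \<mu>"
proof (rule measure_eqI_generator_eq[OF Int_stable_local_sets])
  show "local_sets \<subseteq> Pow (circle_factor k l)"
    using sets.sets_into_space[of _ borel_K] by (auto simp: local_sets_def space_borel_K)
  show "sets \<nu> = sigma_sets (circle_factor k l) local_sets" "sets \<mu> = sigma_sets (circle_factor k l) local_sets"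
    using \<nu> \<mu> by (simp_all add: circle_measure_def sets_borel_K_eq)
  have top: "circle_factor k l \<in> local_sets"
    unfolding local_sets_def using sets.top[of borel_K] by (auto simp: space_borel_K)
  show "range (\<lambda>i :: nat. circle_factor k l) \<subseteq> local_sets" "(\<Union>i :: nat. circle_factor k l) = circle_factor k l"
    using top by auto
  interpret N: prob_space \<nu> using \<nu> by (simp add: circle_measure_def)
  interpret M: prob_space \<mu> using \<mu> by (simp add: circle_measure_def)
  show "emeasure \<nu> (circle_factor k l) \<noteq> \<infinity>" by simp
  fix S assume S: "S \<in> local_sets"
  obtain L where L: "\<And>x y. x \<in> circle_factor k l \<Longrightarrow> y \<in> circle_factor k l \<Longrightarrow>
      (\<And>s. \<bar>s\<bar> \<le> int L \<Longrightarrow> x s = y s) \<Longrightarrow> (x \<in> S \<longleftrightarrow> y \<in> S)" using local_setsE[OF S] by blast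
  have SK: "S \<in> sets borel_K" "S \<subseteq> circle_factor k l"
    using S sets.sets_into_space[of S borel_K] by (auto simp: local_sets_def space_borel_K)
  have Ss: "S \<in> sets \<nu>" "S \<in> sets \<mu>" using SK \<nu> \<mu> by (auto simp: circle_measure_def)
  \<comment> \<open>Membership in S is extended to all sequences, because the frequency evaluates it
    at periodic sequences, which need not lie in the circle factor.\<close>
  define Q where "Q y \<longleftrightarrow> (\<exists>x\<in>S. \<forall>s. \<bar>s\<bar> \<le> int L \<longrightarrow> x s = y s)" for y
  have QS: "Q x \<longleftrightarrow> x \<in> S" if "x \<in> circle_factor k l" for x
    unfolding Q_def using L that SK(2) by blast
  have Q: "Q y = Q z" if "\<And>s. \<bar>s\<bar> \<le> int L \<Longrightarrow> y s = z s" for y z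
    unfolding Q_def using that by auto
  obtain n0 where n0: "\<And>i. i \<ge> n0 \<Longrightarrow> l i \<ge> 2" using eventually_l_ge2 by (auto simp: eventually_sequentially)
  have "\<bar>measure \<nu> S - measure \<mu> S\<bar> \<le> 0"
  proof (rule field_le_epsilon)
    fix e :: real assume e: "0 < e"
    have e4: "0 < e / 4" using e by simp
    from eventually_happens'[OF sequentially_bot eventually_conj[OF
        order_tendstoD(2)[OF spacer_win_tendsto[OF \<nu>] e4] order_tendstoD(2)[OF spacer_win_tendsto[OF \<mu>] e4]]]
    obtain M where M: "measure \<nu> {x \<in> circle_factor k l. spacer_win M x} < e / 4"
      "measure \<mu> {x \<in> circle_factor k l. spacer_win M x} < e / 4" by auto
    \<comment> \<open>M is fixed first to make both spacer terms small; then n is taken large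
      relative to M, so that four errors of e/4 remain.\<close>
    define n where "n = max n0 (nat \<lceil>8 * real (M + 2 * L) / e\<rceil> + 1)"
    have "8 * real (M + 2 * L) / e \<le> real n" unfolding n_def by linarith
    also have "real n \<le> real (q n)" using q_ge[of n] by simp
    finally have qn: "2 * real (M + 2 * L) / q n \<le> e / 4" using e by (simp add: field_simps)
    have l2: "l i \<ge> 2" if "i \<ge> n" for i using that n0 by (simp add: n_def)
    have "\<bar>measure \<nu> S - freq (w n) Q\<bar> \<le> measure \<nu> {x \<in> circle_factor k l. spacer_win M x} + 2 * real (M + 2 * L) / q n"
      by (rule measure_near_freq[OF \<nu> Ss(1) l2 QS Q])
    moreover have "\<bar>measure \<mu> S - freq (w n) Q\<bar> \<le> measure \<mu> {x \<in> circle_factor k l. spacer_win M x} + 2 * real (M + 2 * L) / q n"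
      by (rule measure_near_freq[OF \<mu> Ss(2) l2 QS Q])
    ultimately show "\<bar>measure \<nu> S - measure \<mu> S\<bar> \<le> 0 + e" using M qn by linarith
  qed
  thus "emeasure \<nu> S = emeasure \<mu> S" by (simp add: N.emeasure_eq_measure M.emeasure_eq_measure)
qed

end

theorem mainTheorem4:
  fixes k l :: "nat \<Rightarrow> nat"
  assumes k2: "\<And>n. k n \<ge> 2"
    and lpos: "\<And>n. l n \<ge> 1"
    and lsum: "summable (\<lambda>n. 1 / real (l n))"
  shows "\<exists>\<alpha>. circ_alpha k l \<longlonglongrightarrow> \<alpha> \<and> \<alpha> \<notin> \<rat> \<and>
           (\<exists>!\<nu>. circle_measure k l \<nu>) \<and>
           (\<forall>\<nu>. circle_measure k l \<nu> \<longrightarrow>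
              mt_isomorphic \<nu> sh circle_lebesgue (rot \<alpha>))"
proof -
  interpret circ_seq k l using assms by unfold_locales
  show ?thesis
    using al_tendsto alpha_irrational circle_measure_nu0 isomorphic_nu0 circle_measure_unique
    by blast
qed

end
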